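(* Let $k$ be a field and let $m, n, q$ be positive integers. Let $k[X] = k[x_{i,j} : 1\le i\le m,\ 1\le j\le n]$, let $I_2(X)$ be the ideal generated by the $2\times 2$ minors of the generic matrix $[x_{i,j}]$, and let $R = k[X]/I_2(X)$. Then the generalized Hilbert-Kunz function $$\mathrm{HK}_{R,X}(q) = \mathrm{length}\left(\frac{k[X]}{I_2(X) + (x_{i,j}^q : 1\le i\le m,\ 1\le j\le n)}\right)$$ equals $$N_q(m,n;\overline{\infty};\overline{\infty}) = N_q(m,n;\overline{\infty};\overline{q-1}) + M_q(m,n;\overline{q-1};\overline{q-1})$$ $$= \sum_{i=1}^{n} (-1)^{n-i}\binom{n}{i}\binom{iq+m-1}{m+n-1} + \sum_{i=1}^{n}\sum_{j=1}^{m} (-1)^{m-j+i-1}\binom{n}{i}\binom{m}{j}\binom{jq-iq+n-1}{m+n-1}.$$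
   Context: Length means length as a $k[X]$-module, equivalently dimension as a $k$-vector space. The field $k$ has arbitrary characteristic. A monomial $\prod_{i,j} x_{i,j}^{p_{i,j}}$ (with $1\le i\le m$, $1\le j\le n$, and non-negative integer exponents $p_{i,j}$) is called a staircase monomial if whenever $p_{i,j}>0$ and $i'<i$, $j<j'$, then $p_{i',j'}=0$. For $r_1,\ldots,r_m,c_1,\ldots,c_n\in\{0,1,2,\ldots\}\cup\{\infty\}$, $N_q(m,n;r_1,\ldots,r_m;c_1,\ldots,c_n)$ is the number of staircase monomials $\prod_{i,j} x_{i,j}^{p_{i,j}}$ such that: (i) $\sum_j p_{i,j}\le r_i$ for all $i\in\{1,\ldots,m\}$ and $\sum_i p_{i,j}\le c_j$ for all $j\in\{1,\ldots,n\}$; and (ii) either $\sum_j p_{i,j}<q$ for all $i\in\{1,\ldots,m\}$, or $\sum_i p_{i,j}<q$ for all $j\in\{1,\ldots,n\}$. $M_q(m,n;r_1,\ldots,r_m;c_1,\ldots,c_n)$ is the number of staircase monomials $\prod_{i,j} x_{i,j}^{p_{i,j}}$ such that $\sum_j p_{i,j}\le\min\{r_i,q-1\}$ for all $i\in\{1,\ldots,m\}$, and there exists $j\in\{1,\ldots,n\}$ with $\sum_i p_{i,j}>c_j$. The notation $\overline{c}$ stands for the sequence $c,c,\ldots,c$ of the appropriate length. Binomial coefficients $\binom{a}{b}$ with integers $a$ and $b\ge 0$ are the combinatorial ones: $\binom{a}{b}=0$ whenever $a<b$, including all negative $a$. *)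

theory Defs
  imports
    "HOL-Library.Poly_Mapping"
    "HOL-Library.Extended_Nat"
    "HOL-Algebra.QuotRing"
    "HOL-Algebra.Module"
begin

section \<open>Length of a module\<close>

definition quot_module :: "('a, 'b) ring_scheme \<Rightarrow> 'a set \<Rightarrow> ('a, 'a set) module" where
  "quot_module S I =
    \<lparr> carrier = carrier (S Quot I), mult = mult (S Quot I), one = one (S Quot I),
      zero = zero (S Quot I), add = add (S Quot I),
      smult = (\<lambda>a A. (I +>\<^bsub>S\<^esub> a) \<otimes>\<^bsub>S Quot I\<^esub> A) \<rparr>"

definition module_length :: "('a, 'b) ring_scheme \<Rightarrow> ('a, 'c, 'd) module_scheme \<Rightarrow> enat" where
  "module_length S M =
    Sup {enat l | l. \<exists>N :: nat \<Rightarrow> 'c set.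
           (\<forall>i\<le>l. submodule (N i) S M) \<and> (\<forall>i<l. N i \<subset> N (Suc i))}"

section \<open>Polynomials in the entries of a generic matrix\<close>

text \<open>
  The variable \<open>x\<^sub>i\<^sub>j\<close> is indexed by the pair \<open>(i, j)\<close>; a monomial is its finitely supported
  exponent function, and a polynomial is a finitely supported function from monomials to
  coefficients, with the convolution product of \<^theory>\<open>HOL-Library.Poly_Mapping\<close>.
\<close>

type_synonym monomial = "(nat \<times> nat) \<Rightarrow>\<^sub>0 nat"
type_synonym 'k polynomial = "monomial \<Rightarrow>\<^sub>0 'k"

definition monomials :: "nat \<Rightarrow> nat \<Rightarrow> monomial set" where
  "monomials m n = {p. Poly_Mapping.keys p \<subseteq> {1..m} \<times> {1..n}}"

definition poly_ring :: "nat \<Rightarrow> nat \<Rightarrow> 'k::field polynomial ring" where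
  "poly_ring m n =
    \<lparr> carrier = {f. Poly_Mapping.keys f \<subseteq> monomials m n}, mult = (*), one = 1, zero = 0, add = (+) \<rparr>"

definition var :: "nat \<Rightarrow> nat \<Rightarrow> 'k::field polynomial" where
  "var i j = Poly_Mapping.single (Poly_Mapping.single (i, j) 1) 1"

definition vars :: "nat \<Rightarrow> nat \<Rightarrow> 'k::field polynomial set" where
  "vars m n = {var i j | i j. i \<in> {1..m} \<and> j \<in> {1..n}}"

definition minors2 :: "nat \<Rightarrow> nat \<Rightarrow> 'k::field polynomial set" where
  "minors2 m n =
    {var i j * var i' j' - var i j' * var i' j | i i' j j'.
       i \<in> {1..m} \<and> i' \<in> {1..m} \<and> i < i' \<and> j \<in> {1..n} \<and> j' \<in> {1..n} \<and> j < j'}"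

definition I2 :: "nat \<Rightarrow> nat \<Rightarrow> 'k::field polynomial set" where
  "I2 m n = Idl\<^bsub>poly_ring m n\<^esub> (minors2 m n)"

text \<open>
  For an ideal \<open>I\<close> of \<open>S\<close> and a set \<open>X\<close> of elements of \<open>S\<close>, this is the length of
  \<open>S / (I + (x^q : x \<in> X))\<close>, i.e. the generalized Hilbert-Kunz function of \<open>R = S / I\<close>
  with respect to (the images of) \<open>X\<close>.
\<close>

definition hilbert_kunz :: "('a, 'b) ring_scheme \<Rightarrow> 'a set \<Rightarrow> 'a set \<Rightarrow> nat \<Rightarrow> enat" where
  "hilbert_kunz S I X q =
    module_length S (quot_module S (I <+>\<^bsub>S\<^esub> Idl\<^bsub>S\<^esub> {x [^]\<^bsub>S\<^esub> q | x. x \<in> X}))"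

section \<open>Counting staircase monomials\<close>

definition staircase :: "nat \<Rightarrow> nat \<Rightarrow> monomial \<Rightarrow> bool" where
  "staircase m n p \<longleftrightarrow> p \<in> monomials m n \<and>
    (\<forall>i\<in>{1..m}. \<forall>j\<in>{1..n}. \<forall>i'\<in>{1..m}. \<forall>j'\<in>{1..n}.
       Poly_Mapping.lookup p (i, j) > 0 \<and> i' < i \<and> j < j' \<longrightarrow> Poly_Mapping.lookup p (i', j') = 0)"

definition row_sum :: "nat \<Rightarrow> monomial \<Rightarrow> nat \<Rightarrow> nat" where
  "row_sum n p i = (\<Sum>j=1..n. Poly_Mapping.lookup p (i, j))"

definition col_sum :: "nat \<Rightarrow> monomial \<Rightarrow> nat \<Rightarrow> nat" where
  "col_sum m p j = (\<Sum>i=1..m. Poly_Mapping.lookup p (i, j))"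

text \<open>
  The sequences \<open>r\<^sub>1, \<dots>, r\<^sub>m\<close> and \<open>c\<^sub>1, \<dots>, c\<^sub>n\<close> are functions of the index; values outside the
  index range play no role. Both sets below are finite (every row sum, or every column sum, is
  less than \<open>q\<close>, so all exponents are bounded), so the cardinality is genuine. The truncated
  subtraction \<open>q - 1\<close> is harmless since \<open>q\<close> is positive throughout.
\<close>

definition N_count :: "nat \<Rightarrow> nat \<Rightarrow> nat \<Rightarrow> (nat \<Rightarrow> enat) \<Rightarrow> (nat \<Rightarrow> enat) \<Rightarrow> nat" where
  "N_count q m n r c = card {p. staircase m n p \<and>
     (\<forall>i\<in>{1..m}. enat (row_sum n p i) \<le> r i) \<and>
     (\<forall>j\<in>{1..n}. enat (col_sum m p j) \<le> c j) \<and>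
     ((\<forall>i\<in>{1..m}. row_sum n p i < q) \<or> (\<forall>j\<in>{1..n}. col_sum m p j < q))}"

definition M_count :: "nat \<Rightarrow> nat \<Rightarrow> nat \<Rightarrow> (nat \<Rightarrow> enat) \<Rightarrow> (nat \<Rightarrow> enat) \<Rightarrow> nat" where
  "M_count q m n r c = card {p. staircase m n p \<and>
     (\<forall>i\<in>{1..m}. enat (row_sum n p i) \<le> min (r i) (enat (q - 1))) \<and>
     (\<exists>j\<in>{1..n}. enat (col_sum m p j) > c j)}"

text \<open>
  Combinatorial convention for integer upper argument: zero whenever \<open>a < b\<close>, in particular for
  all negative \<open>a\<close> (unlike \<open>a gchoose b\<close>).
\<close>

definition binom :: "int \<Rightarrow> nat \<Rightarrow> int" where
  "binom a b = (if a < int b then 0 else int (nat a choose b))"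

end

theory Submission
  imports Defs
begin

text \<open>
  The ring \<open>k[X]/I\<^sub>2(X)\<close> is the Segre ring spanned by the products of a monomial in
  \<open>y\<^sub>1, \<dots>, y\<^sub>m\<close> with a monomial of the same degree in \<open>z\<^sub>1, \<dots>, z\<^sub>n\<close> (\<open>x\<^sub>i\<^sub>j\<close> maps to \<open>y\<^sub>i z\<^sub>j\<close>),
  so a monomial modulo \<open>I\<^sub>2\<close> is determined by its row sums and column sums, and each pair of
  exponent vectors of equal degree is realised by exactly one staircase monomial. The powers
  \<open>x\<^sub>i\<^sub>j^q\<close> kill precisely the monomials with some row sum and some column sum at least \<open>q\<close>. Hence the
  surviving staircase monomials span the quotient, which bounds the length from above; adding
  them one at a time in order of decreasing degree gives a chain of ideals of that length. The closed
  formula follows by counting pairs of integer vectors of equal sum, using finite differences of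
  binomial coefficients and inclusion-exclusion.
\<close>

section \<open>Length of a cyclic module as a supremum over chains of ideals\<close>

text \<open>The lattice correspondence: images and preimages under the quotient map turn strict
  chains of ideals above \<open>J\<close> into strict chains of submodules and back, with the same
  number of steps.\<close>

lemma (in cring) module_length_quot_module:
  assumes "ideal J R"
  shows "module_length R (quot_module R J) =
    Sup {enat l | l. \<exists>K. (\<forall>i\<le>l. ideal (K i) R \<and> J \<subseteq> K i) \<and> (\<forall>i<l. K i \<subset> K (Suc i))}"
proof -
  interpret J: ideal J R by fact
  \<comment> \<open>\<open>quot_module\<close> copies its additive structure from the factor ring,
    so subgroup facts proved there carry over.\<close>
  have am: "subgroup K (add_monoid (quot_module R J)) \<longleftrightarrow> subgroup K (add_monoid (R Quot J))" for K
    by (simp add: subgroup_def m_inv_def quot_module_def)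
  have carr: "carrier (quot_module R J) = (+>) J ` carrier R"
    by (auto simp: quot_module_def FactRing_simps)
  have smult: "a \<odot>\<^bsub>quot_module R J\<^esub> (J +> f) = J +> a \<otimes> f" if "a \<in> carrier R" "f \<in> carrier R" for a f
    using that by (simp add: quot_module_def FactRing_def J.rcoset_mult_add)
  have eq: "J +> f = J +> g \<Longrightarrow> f \<in> carrier R \<Longrightarrow> g \<in> carrier R \<Longrightarrow> \<exists>h\<in>J. f = h \<oplus> g" for f g
    using J.a_rcos_self[of f] by (auto simp add: a_r_coset_def r_coset_def)
  have 1: "submodule ((+>) J ` K) R (quot_module R J)" if "ideal K R" for K
  proof -
    interpret K: ideal K R by fact
    show ?thesis
    proof (intro submodule.intro submodule_axioms.intro)
      show "subgroup ((+>) J ` K) (add_monoid (quot_module R J))"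
      proof -
        interpret h: ring_hom_ring R "R Quot J" "(+>) J"
          by (rule J.rcos_ring_hom_ring)
        show ?thesis
          unfolding am by (rule group_hom.subgroup_img_is_subgroup[OF h.a_group_hom K.a_subgroup])
      qed
    next
      fix a x assume "a \<in> carrier R" "x \<in> (+>) J ` K"
      then show "a \<odot>\<^bsub>quot_module R J\<^esub> x \<in> (+>) J ` K"
        using K.I_l_closed by (auto simp: smult K.a_Hcarr)
    qed
  qed
  have 2: "(+>) J ` K \<subset> (+>) J ` L"
    if "ideal K R" "ideal L R" "J \<subseteq> K" "K \<subset> L" for K L
  proof -
    interpret K: ideal K R by fact
    interpret L: ideal L R by fact
    obtain f where f: "f \<in> L" "f \<notin> K" using \<open>K \<subset> L\<close> by blast
    \<comment> \<open>Otherwise \<open>f\<close> would differ from a member of \<open>K\<close> by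
      an element of \<open>J\<close>, which itself lies in \<open>K\<close>; this is where
      strictness uses \<open>J \<subseteq> K\<close>.\<close>
    have "J +> f \<notin> (+>) J ` K"
    proof
      assume "J +> f \<in> (+>) J ` K"
      then obtain g where "g \<in> K" "J +> f = J +> g" by auto
      then obtain h where "h \<in> J" "f = h \<oplus> g" using eq f L.a_Hcarr K.a_Hcarr by blast
      with \<open>g \<in> K\<close> \<open>J \<subseteq> K\<close> f show False by (auto intro: K.a_closed)
    qed
    with f \<open>K \<subset> L\<close> show ?thesis by blast
  qed
  let ?P = "\<lambda>N. {f \<in> carrier R. J +> f \<in> N}"
  have 3: "ideal (?P N) R \<and> J \<subseteq> ?P N" if "submodule N R (quot_module R J)" for N
  proof -
    interpret N: submodule N R "quot_module R J" by fact
    have z: "J \<in> N" using N.one_closed by (simp add: quot_module_def FactRing_simps)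
    have add: "J +> f \<oplus> g \<in> N" if "J +> f \<in> N" "J +> g \<in> N" "f \<in> carrier R" "g \<in> carrier R" for f g
      using N.m_closed[OF that(1,2)] that(3,4)
      by (simp add: quot_module_def FactRing_def J.a_rcos_sum)
    have sm: "J +> a \<otimes> f \<in> N" if "J +> f \<in> N" "f \<in> carrier R" "a \<in> carrier R" for f a
      using N.smult_closed[OF that(3,1)] that by (simp add: smult)
    have "J \<subseteq> ?P N"
      using z J.a_rcos_const by auto
    moreover have "ideal (?P N) R"
    proof (rule idealI)
      show "ring R" by (rule ring_axioms)
      show "subgroup (?P N) (add_monoid R)"
      proof (rule add.subgroupI)
        show "?P N \<noteq> {}" using \<open>J \<subseteq> ?P N\<close> J.zero_closed by blast
        \<comment> \<open>Negation is scalar multiplication by \<open>\<ominus> \<one>\<close>, so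
          it follows from closure under scalars.\<close>
        show "\<ominus> a \<in> ?P N" if "a \<in> ?P N" for a
          using that sm[of a "\<ominus> \<one>"] by (simp add: l_minus)
        show "a \<oplus> b \<in> ?P N" if "a \<in> ?P N" "b \<in> ?P N" for a b
          using that add[of a b] by simp
      qed simp
      show "x \<otimes> a \<in> ?P N" if "a \<in> ?P N" "x \<in> carrier R" for a x
        using that sm[of a x] by simp
      then show "a \<otimes> x \<in> ?P N" if "a \<in> ?P N" "x \<in> carrier R" for a x
        using that m_comm[of a x] by simp
    qed
    ultimately show ?thesis by blast
  qed
  have 4: "?P N \<subset> ?P M" if "submodule M R (quot_module R J)" "N \<subset> M"
    for M N
  proof -
    obtain C where C: "C \<in> M" "C \<notin> N" using \<open>N \<subset> M\<close> by blast
    interpret M: submodule M R "quot_module R J" by fact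
    \<comment> \<open>Surjectivity of the quotient map: a coset separating \<open>M\<close> from
      \<open>N\<close> has a representative, which separates the preimages.\<close>
    have "C \<in> (+>) J ` carrier R" using C M.subset carr by auto
    with C \<open>N \<subset> M\<close> show ?thesis by blast
  qed
  have "(\<exists>N. (\<forall>i\<le>l. submodule (N i) R (quot_module R J)) \<and> (\<forall>i<l. N i \<subset> N (Suc i))) \<longleftrightarrow>
    (\<exists>K. (\<forall>i\<le>l. ideal (K i) R \<and> J \<subseteq> K i) \<and> (\<forall>i<l. K i \<subset> K (Suc i)))" for l
  proof safe
    fix N :: "nat \<Rightarrow> 'a set set" assume "\<forall>i\<le>l. submodule (N i) R (quot_module R J)" "\<forall>i<l. N i \<subset> N (Suc i)"
    then show "\<exists>K. (\<forall>i\<le>l. ideal (K i) R \<and> J \<subseteq> K i) \<and> (\<forall>i<l. K i \<subset> K (Suc i))"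
      by (intro exI[of _ "\<lambda>i. ?P (N i)"] conjI allI impI 4) (auto dest: 3)
  next
    fix K :: "nat \<Rightarrow> 'a set" assume K: "\<forall>i\<le>l. ideal (K i) R \<and> J \<subseteq> K i" "\<forall>i<l. K i \<subset> K (Suc i)"
    then show "\<exists>N. (\<forall>i\<le>l. submodule (N i) R (quot_module R J)) \<and> (\<forall>i<l. N i \<subset> N (Suc i))"
      by (intro exI[of _ "\<lambda>i. (+>) J ` K i"] conjI allI impI 1 2) auto
  qed
  then show ?thesis unfolding module_length_def by simp
qed

section \<open>Counting integer vectors of given sum\<close>

lemma binom_rec: "binom (a + 1) (Suc k) - binom a (Suc k) = binom a k"
proof (cases "a \<ge> 0")
  case True
  then obtain b where "a = int b" using nonneg_eq_int by blast
  then show ?thesis by (auto simp: binom_def nat_add_distrib)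
next
  \<comment> \<open>Truncation makes all three terms vanish; at the boundary \<open>a = -1\<close>
    this also uses \<open>0 choose Suc k = 0\<close>.\<close>
  case False
  then show ?thesis by (auto simp: binom_def)
qed

lemma sum_binom: "(\<Sum>a<q. binom (x + int a) k) = binom (x + int q) (Suc k) - binom x (Suc k)"
proof (induction q)
  case (Suc q)
  then show ?case using binom_rec[of "x + int q" k] by (simp add: algebra_simps)
qed simp

text \<open>Lists encode the exponent vectors of the \<open>y\<close> or \<open>z\<close> variables,
  so that counts can go by induction, splitting off the head.\<close>

definition tuples :: "nat \<Rightarrow> nat \<Rightarrow> nat list set" where
  "tuples n q = {xs. length xs = n \<and> (\<forall>x\<in>set xs. x < q)}"

lemma tuples_0: "tuples 0 q = {[]}"
  by (auto simp: tuples_def)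

lemma tuples_Suc: "tuples (Suc n) q = (\<lambda>(x, xs). x # xs) ` ({..<q} \<times> tuples n q)"
  by (force simp: tuples_def length_Suc_conv)

lemma finite_tuples [simp, intro]: "finite (tuples n q)"
  by (induction n) (auto simp: tuples_0 tuples_Suc)

lemma sum_tuples_Suc: "(\<Sum>xs\<in>tuples (Suc n) q. f xs) = (\<Sum>x<q. \<Sum>xs\<in>tuples n q. f (x # xs))"
  unfolding tuples_Suc
  by (subst sum.reindex) (auto simp: inj_on_def sum.cartesian_product case_prod_unfold)

text \<open>With \<open>E\<close> the shift operator, the alternating sum is
  \<open>(1 - E)^n\<close> evaluated at 0; applying it to \<open>(1 - E) g\<close> gives the next
  power, by Pascal's rule.\<close>

lemma alternating_sum_choose_backward:
  fixes g :: "nat \<Rightarrow> int"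
  shows "(\<Sum>i\<le>n. (-1) ^ i * int (n choose i) * (g i - g (Suc i)))
    = (\<Sum>i\<le>Suc n. (-1) ^ i * int (Suc n choose i) * g i)"
proof -
  have "(\<Sum>i\<le>Suc n. (-1) ^ i * int (Suc n choose i) * g i)
     = g 0 + (\<Sum>i\<le>n. (-1) ^ Suc i * int (Suc n choose Suc i) * g (Suc i))"
    by (subst sum.atMost_Suc_shift) simp
  also have "\<dots> = g 0 + (\<Sum>i\<le>n. (-1) ^ Suc i * int (n choose Suc i) * g (Suc i))
      - (\<Sum>i\<le>n. (-1) ^ i * int (n choose i) * g (Suc i))"
    by (simp add: algebra_simps sum.distrib sum_negf sum_subtractf)
  also have "g 0 + (\<Sum>i\<le>n. (-1) ^ Suc i * int (n choose Suc i) * g (Suc i))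
    = (\<Sum>i\<le>Suc n. (-1) ^ i * int (n choose i) * g i)"
    by (subst sum.atMost_Suc_shift) simp
  \<comment> \<open>The top term drops out because \<open>n choose Suc n = 0\<close>.\<close>
  also have "\<dots> = (\<Sum>i\<le>n. (-1) ^ i * int (n choose i) * g i)" by simp
  finally show ?thesis by (simp add: algebra_simps sum_subtractf)
qed

text \<open>The same for powers of \<open>E - 1\<close>, which differ from the backward version by
  the global sign \<open>(-1) ^ Suc n\<close>.\<close>

lemma alternating_sum_choose_forward:
  fixes g :: "nat \<Rightarrow> int"
  shows "(\<Sum>i\<le>n. (-1) ^ (n - i) * int (n choose i) * (g (Suc i) - g i))
    = (\<Sum>i\<le>Suc n. (-1) ^ (Suc n - i) * int (Suc n choose i) * g i)"
proof -
  have s: "(-1) ^ (k - i) = (-1) ^ k * ((-1) ^ i :: int)" if "i \<le> k" for i k :: nat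
    using that by (simp add: minus_one_power_iff)
  have "(\<Sum>i\<le>n. (-1) ^ (n - i) * int (n choose i) * (g (Suc i) - g i))
    = (-1) ^ Suc n * (\<Sum>i\<le>n. (-1) ^ i * int (n choose i) * (g i - g (Suc i)))"
    unfolding sum_distrib_left by (rule sum.cong) (auto simp: s algebra_simps)
  also have "\<dots> = (\<Sum>i\<le>Suc n. (-1) ^ (Suc n - i) * int (Suc n choose i) * g i)"
    unfolding alternating_sum_choose_backward sum_distrib_left by (rule sum.cong) (auto simp: s algebra_simps)
  finally show ?thesis .
qed

text \<open>By \<open>sum_binom\<close>, summing over one coordinate raises the lower index by one
  and takes a forward difference of step \<open>q\<close>; the \<open>n\<close> coordinates give the
  \<open>n\<close>-th difference. The shift \<open>x\<close> varies because it absorbs the head of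
  the list.\<close>

lemma sum_tuples_binom:
  "(\<Sum>xs\<in>tuples n q. binom (x + int (sum_list xs)) k)
    = (\<Sum>i\<le>n. (-1) ^ (n - i) * int (n choose i) * binom (x + int i * int q) (k + n))"
proof (induction n arbitrary: x)
  case (Suc n)
  let ?g = "\<lambda>i. binom (x + int i * int q) (k + Suc n)"
  have "(\<Sum>xs\<in>tuples (Suc n) q. binom (x + int (sum_list xs)) k)
     = (\<Sum>a<q. \<Sum>xs\<in>tuples n q. binom ((x + int a) + int (sum_list xs)) k)"
    by (simp add: sum_tuples_Suc algebra_simps)
  also have "\<dots> = (\<Sum>i\<le>n. (-1) ^ (n - i) * int (n choose i) * (\<Sum>a<q. binom ((x + int i * int q) + int a) (k + n)))"
    unfolding Suc.IH sum_distrib_left by (subst sum.swap) (simp add: algebra_simps)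
  also have "\<dots> = (\<Sum>i\<le>n. (-1) ^ (n - i) * int (n choose i) * (?g (Suc i) - ?g i))"
    unfolding sum_binom by (simp add: algebra_simps)
  also have "\<dots> = (\<Sum>i\<le>Suc n. (-1) ^ (Suc n - i) * int (Suc n choose i) * ?g i)"
    by (rule alternating_sum_choose_forward)
  finally show ?case .
qed (simp add: tuples_0)

text \<open>
  The number of vectors of \<open>n\<close> natural numbers with sum \<open>d\<close>, with value \<open>0\<close> at negative \<open>d\<close>, so that
  its difference equation holds for every integer \<open>d\<close>.
\<close>

definition ncomp :: "nat \<Rightarrow> int \<Rightarrow> int" where
  "ncomp n d = (if n = 0 then of_bool (d = 0) else binom (d + int n - 1) (n - 1))"

lemma card_compositions: "int (card {xs::nat list. length xs = n \<and> sum_list xs = d}) = ncomp n (int d)"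
proof (cases n)
  case (Suc k)
  \<comment> \<open>Stars and bars gives \<open>(d + k) choose d\<close>, whereas
    \<open>ncomp\<close> has the complementary lower index \<open>k\<close>.\<close>
  then show ?thesis
    using binomial_symmetric[of k "d + k"]
    by (simp add: card_length_sum_list ncomp_def binom_def nat_add_distrib add.commute)
next
  case 0
  then have "{xs::nat list. length xs = n \<and> sum_list xs = d} = (if d = 0 then {[]} else {})" by auto
  then show ?thesis using 0 by (simp add: ncomp_def)
qed

lemma sum_ncomp: "(\<Sum>a<q. ncomp n (d - int a)) = ncomp (Suc n) d - ncomp (Suc n) (d - int q)"
proof (induction q)
  case (Suc q)
  \<comment> \<open>Among vectors of length \<open>Suc n\<close> and sum \<open>x\<close>, those
    with positive head correspond to vectors of sum \<open>x - 1\<close>; the others have head 0 and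
    leave a vector of length \<open>n\<close>.\<close>
  have "ncomp n x = ncomp (Suc n) x - ncomp (Suc n) (x - 1)" for x
  proof (cases n)
    case 0
    then show ?thesis by (auto simp: ncomp_def binom_def)
  next
    case (Suc k)
    then show ?thesis using binom_rec[of "x + int k" k] by (simp add: ncomp_def ac_simps)
  qed
  from this[of "d - int q"] show ?case using Suc by (simp add: algebra_simps)
qed simp

text \<open>Inclusion-exclusion over the set of coordinates forced to be at least \<open>q\<close>,
  obtained here as an iterated backward difference of step \<open>q\<close>. The target
  \<open>d\<close> is an integer because removing the head can make it negative.\<close>

lemma card_tuples_sum_list:
  "int (card {xs \<in> tuples n q. int (sum_list xs) = d})
    = (\<Sum>i\<le>n. (-1) ^ i * int (n choose i) * ncomp n (d - int i * int q))"
proof (induction n arbitrary: d)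
  case (Suc n)
  let ?g = "\<lambda>i. ncomp (Suc n) (d - int i * int q)"
  have "int (card {xs \<in> tuples (Suc n) q. int (sum_list xs) = d})
    = (\<Sum>xs\<in>tuples (Suc n) q. of_bool (int (sum_list xs) = d))"
    by (simp add: Int_def)
  also have "\<dots> = (\<Sum>a<q. int (card {xs \<in> tuples n q. int (sum_list xs) = d - int a}))"
    by (simp add: sum_tuples_Suc Int_def algebra_simps)
  also have "\<dots> = (\<Sum>i\<le>n. (-1) ^ i * int (n choose i) * (\<Sum>a<q. ncomp n ((d - int i * int q) - int a)))"
    unfolding Suc.IH sum_distrib_left by (subst sum.swap) (simp add: algebra_simps)
  also have "\<dots> = (\<Sum>i\<le>n. (-1) ^ i * int (n choose i) * (?g i - ?g (Suc i)))"
    unfolding sum_ncomp by (simp add: algebra_simps)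
  also have "\<dots> = (\<Sum>i\<le>Suc n. (-1) ^ i * int (Suc n choose i) * ?g i)"
    by (rule alternating_sum_choose_backward)
  finally show ?case .
next
  case 0
  have "{xs \<in> tuples 0 q. int (sum_list xs) = d} = (if d = 0 then {[]} else {})"
    by (auto simp: tuples_0)
  then show ?case by (simp add: ncomp_def)
qed

lemma finite_sum_list_eq: "finite {xs::nat list. length xs = n \<and> sum_list xs = d}"
proof (rule finite_subset)
  show "{xs. length xs = n \<and> sum_list xs = d} \<subseteq> {xs. set xs \<subseteq> {..d} \<and> length xs = n}"
    using member_le_sum_list by fastforce
qed (simp add: finite_lists_length_eq)

section \<open>Closed formulas for pairs of vectors of equal sum\<close>

lemma card_unbounded_small:
  assumes "m > 0" "n > 0"
  shows "int (card {(r, c). length r = m \<and> c \<in> tuples n q \<and> sum_list r = sum_list c})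
    = (\<Sum>i=1..n. (-1) ^ (n - i) * int (n choose i) * binom (int i * int q + int m - 1) (m + n - 1))"
proof -
  let ?S = "{(r, c). length r = m \<and> c \<in> tuples n q \<and> sum_list r = sum_list c}"
  have "?S = (\<lambda>(c, r). (r, c)) ` (SIGMA c:tuples n q. {r. length r = m \<and> sum_list r = sum_list c})"
    by force
  then have "card ?S = (\<Sum>c\<in>tuples n q. card {r::nat list. length r = m \<and> sum_list r = sum_list c})"
    by (simp add: card_image inj_on_def finite_sum_list_eq)
  \<comment> \<open>The bounded vector \<open>c\<close> is fixed first; stars and bars counts the
    free vector \<open>r\<close> of the same sum.\<close>
  then have "int (card ?S) = (\<Sum>c\<in>tuples n q. binom ((int m - 1) + int (sum_list c)) (m - 1))"
    using assms by (simp add: card_compositions ncomp_def algebra_simps)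
  also have "\<dots> = (\<Sum>i\<le>n. (-1) ^ (n - i) * int (n choose i) * binom ((int m - 1) + int i * int q) (m - 1 + n))"
    by (rule sum_tuples_binom)
  \<comment> \<open>The term \<open>i = 0\<close> vanishes: its upper argument \<open>m - 1\<close>
    is below \<open>m + n - 1\<close>.\<close>
  also have "\<dots> = (\<Sum>i=1..n. (-1) ^ (n - i) * int (n choose i) * binom (int i * int q + int m - 1) (m + n - 1))"
    using assms by (intro sum.mono_neutral_cong_right) (auto simp: binom_def algebra_simps not_le)
  finally show ?thesis .
qed

text \<open>For fixed \<open>r\<close>, the vectors \<open>c\<close> leaving the box are all vectors
  of that sum minus those inside, counted by inclusion-exclusion; summing over \<open>r\<close> is
  again an iterated difference.\<close>

lemma card_small_unbounded:
  assumes "n > 0" "m > 0"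
  shows "int (card {(r, c). r \<in> tuples m q \<and> length c = n \<and> c \<notin> tuples n q \<and> sum_list r = sum_list c})
    = (\<Sum>i=1..n. \<Sum>j=1..m. (-1) ^ (m - j + i - 1) * int (n choose i) * int (m choose j)
                * binom (int j * int q - int i * int q + int n - 1) (m + n - 1))"
proof -
  let ?S = "{(r, c). r \<in> tuples m q \<and> length c = n \<and> c \<notin> tuples n q \<and> sum_list r = sum_list c}"
  let ?T = "\<lambda>d. {c. length c = n \<and> c \<notin> tuples n q \<and> sum_list c = d}"
  have fin: "finite (?T d)" for d by (rule finite_subset[OF _ finite_sum_list_eq[of n d]]) auto
  have T: "int (card (?T d)) = (\<Sum>i=1..n. (-1) ^ (i - 1) * int (n choose i) * binom ((int n - 1 - int i * int q) + int d) (n - 1))" for d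
  proof -
    have "?T d = {c. length c = n \<and> sum_list c = d} - {c \<in> tuples n q. sum_list c = d}" by auto
    then have "card (?T d) = card {c. length c = n \<and> sum_list c = d} - card {c \<in> tuples n q. sum_list c = d}"
      by (auto simp: tuples_def intro!: card_Diff_subset intro: finite_subset[OF _ finite_sum_list_eq[of n d]])
    moreover have "card {c \<in> tuples n q. sum_list c = d} \<le> card {c. length c = n \<and> sum_list c = d}"
      by (rule card_mono[OF finite_sum_list_eq]) (auto simp: tuples_def)
    ultimately have "int (card (?T d)) = ncomp n (int d) - (\<Sum>i\<le>n. (-1) ^ i * int (n choose i) * ncomp n (int d - int i * int q))"
      using card_compositions[of n d] card_tuples_sum_list[of n q "int d"] by simp
    \<comment> \<open>The term \<open>i = 0\<close> is the unrestricted count, so it cancels in the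
      subtraction; the remaining signs flip to \<open>(-1) ^ (i - 1)\<close>.\<close>
    also have "(\<Sum>i\<le>n. (-1) ^ i * int (n choose i) * ncomp n (int d - int i * int q))
      = ncomp n (int d) + (\<Sum>i=1..n. (-1) ^ i * int (n choose i) * ncomp n (int d - int i * int q))"
      by (simp add: atMost_atLeast0 sum.atLeast_Suc_atMost)
    also have "ncomp n (int d) - \<dots> = (\<Sum>i=1..n. - ((-1) ^ i * int (n choose i) * ncomp n (int d - int i * int q)))"
      by (simp add: sum_negf)
    also have "\<dots> = (\<Sum>i=1..n. (-1) ^ (i - 1) * int (n choose i) * binom ((int n - 1 - int i * int q) + int d) (n - 1))"
      using assms by (intro sum.cong) (auto simp: ncomp_def minus_one_power_iff algebra_simps)
    finally show ?thesis .
  qed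
  have "?S = (SIGMA r:tuples m q. ?T (sum_list r))" by auto
  then have "card ?S = (\<Sum>r\<in>tuples m q. card (?T (sum_list r)))"
    using fin by simp
  then have "int (card ?S) = (\<Sum>r\<in>tuples m q. int (card (?T (sum_list r))))" by simp
  also have "\<dots> = (\<Sum>i=1..n. (-1) ^ (i - 1) * int (n choose i) * (\<Sum>r\<in>tuples m q. binom ((int n - 1 - int i * int q) + int (sum_list r)) (n - 1)))"
    unfolding T sum_distrib_left by (rule sum.swap)
  also have "\<dots> = (\<Sum>i=1..n. (-1) ^ (i - 1) * int (n choose i) * (\<Sum>j=1..m. (-1) ^ (m - j) * int (m choose j) * binom (int j * int q - int i * int q + int n - 1) (m + n - 1)))"
  proof (rule sum.cong[OF refl], rule arg_cong2[of _ _ _ _ "(*)"], rule refl)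
    fix i
    \<comment> \<open>This kills the term \<open>j = 0\<close> of the iterated difference, so the
      inner sum starts at 1.\<close>
    have neg: "int n - 1 - int i * int q < int (n - 1 + m)"
      using assms by (smt (verit) mult_nonneg_nonneg of_nat_0_le_iff of_nat_0_less_iff of_nat_add of_nat_diff of_nat_1 Suc_leI One_nat_def)
    show "(\<Sum>r\<in>tuples m q. binom ((int n - 1 - int i * int q) + int (sum_list r)) (n - 1))
      = (\<Sum>j=1..m. (-1) ^ (m - j) * int (m choose j) * binom (int j * int q - int i * int q + int n - 1) (m + n - 1))"
      unfolding sum_tuples_binom using assms neg
      by (intro sum.mono_neutral_cong_right) (auto simp: binom_def algebra_simps not_le)
  qed
  also have "\<dots> = (\<Sum>i=1..n. \<Sum>j=1..m. (-1) ^ (m - j + i - 1) * int (n choose i) * int (m choose j)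
                * binom (int j * int q - int i * int q + int n - 1) (m + n - 1))"
    \<comment> \<open>Since \<open>i \<ge> 1\<close>, the exponents \<open>i - 1\<close> and
      \<open>m - j\<close> add up to the truncated \<open>m - j + i - 1\<close>.\<close>
    unfolding sum_distrib_left
    by (intro sum.cong refl) (auto simp: power_add[symmetric] algebra_simps)
  finally show ?thesis .
qed

section \<open>Row and column sums of staircase monomials\<close>

lemma monomials_lookup_eq_0:
  assumes "p \<in> monomials m n" "x \<notin> {1..m} \<times> {1..n}"
  shows "Poly_Mapping.lookup p x = 0"
  using assms by (auto simp: monomials_def in_keys_iff)

lemma monomials_0 [simp]: "0 \<in> monomials m n"
  by (simp add: monomials_def)

lemma monomials_add [intro]: "p \<in> monomials m n \<Longrightarrow> p' \<in> monomials m n \<Longrightarrow> p + p' \<in> monomials m n"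
  using keys_add[of p p'] by (auto simp: monomials_def)

lemma monomials_single [intro]:
  "i \<in> {1..m} \<Longrightarrow> j \<in> {1..n} \<Longrightarrow> Poly_Mapping.single (i, j) a \<in> monomials m n"
  by (auto simp: monomials_def)

lemma monomials_decomp:
  assumes "p \<in> monomials m n" "a \<le> Poly_Mapping.lookup p x"
  obtains s where "s \<in> monomials m n" "p = s + Poly_Mapping.single x a"
proof
  show "p = (p - Poly_Mapping.single x a) + Poly_Mapping.single x a"
    using assms by (intro poly_mapping_eqI) (auto simp: lookup_add lookup_minus lookup_single when_def)
  show "p - Poly_Mapping.single x a \<in> monomials m n"
  proof -
    have "Poly_Mapping.keys (p - Poly_Mapping.single x a) \<subseteq> Poly_Mapping.keys p"
      by (auto simp: in_keys_iff lookup_minus)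
    with assms(1) show ?thesis by (auto simp: monomials_def)
  qed
qed

lemma row_sum_0 [simp]: "row_sum n 0 i = 0"
  by (simp add: row_sum_def)

lemma col_sum_0 [simp]: "col_sum n 0 i = 0"
  by (simp add: col_sum_def)

lemma row_sum_add: "row_sum n (p + p') i = row_sum n p i + row_sum n p' i"
  by (simp add: row_sum_def lookup_add sum.distrib)

lemma col_sum_add: "col_sum m (p + p') j = col_sum m p j + col_sum m p' j"
  by (simp add: col_sum_def lookup_add sum.distrib)

lemma row_sum_single:
  "j \<in> {1..n} \<Longrightarrow> row_sum n (Poly_Mapping.single (i, j) a) i' = (if i' = i then a else 0)"
  by (auto simp: row_sum_def lookup_single when_def sum.delta)

lemma col_sum_single:
  "i \<in> {1..m} \<Longrightarrow> col_sum m (Poly_Mapping.single (i, j) a) j' = (if j' = j then a else 0)"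
  by (auto simp: col_sum_def lookup_single when_def sum.delta)

text \<open>The exponent pair of the image \<open>y^r z^c\<close> under \<open>x_ij\<close>
  \<mapsto> \<open>y_i z_j\<close>. List positions start at 0 while rows and columns start at 1,
  hence the \<open>Suc\<close> shifts in \<open>weight_add_single\<close>.\<close>

definition weight :: "nat \<Rightarrow> nat \<Rightarrow> monomial \<Rightarrow> nat list \<times> nat list" where
  "weight m n p = (map (row_sum n p) [1..<Suc m], map (col_sum m p) [1..<Suc n])"

lemma weight_eq_iff: "weight m n p = weight m n p' \<longleftrightarrow>
    (\<forall>i\<in>{1..m}. row_sum n p i = row_sum n p' i) \<and> (\<forall>j\<in>{1..n}. col_sum m p j = col_sum m p' j)"
  by (auto simp: weight_def map_eq_conv simp del: upt_Suc)

lemma weight_add_cancel: "weight m n (s + p) = weight m n (s + p') \<longleftrightarrow> weight m n p = weight m n p'"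
  by (simp add: weight_eq_iff row_sum_add col_sum_add)

text \<open>The two terms of a 2x2 minor have the same image in the Segre ring.\<close>

lemma weight_exchange:
  assumes "i \<in> {1..m}" "i' \<in> {1..m}" "j \<in> {1..n}" "j' \<in> {1..n}"
  shows "weight m n (s + (Poly_Mapping.single (i, j) 1 + Poly_Mapping.single (i', j') 1))
    = weight m n (s + (Poly_Mapping.single (i, j') 1 + Poly_Mapping.single (i', j) 1))"
  using assms by (simp add: weight_eq_iff row_sum_add col_sum_add row_sum_single col_sum_single)

text \<open>Straightening as an induction principle: a monomial that is not staircase contains an
  antidiagonal pair of variables, and replacing it by the diagonal pair terminates.\<close>

lemma exchange_induct [consumes 1, case_names staircase exchange]:
  assumes "p \<in> monomials m n"
    and staircase: "\<And>p. staircase m n p \<Longrightarrow> P p"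
    and exchange: "\<And>s i i' j j'. s \<in> monomials m n \<Longrightarrow> i \<in> {1..m} \<Longrightarrow> i' \<in> {1..m} \<Longrightarrow>
      j \<in> {1..n} \<Longrightarrow> j' \<in> {1..n} \<Longrightarrow> i < i' \<Longrightarrow> j < j' \<Longrightarrow>
      P (s + (Poly_Mapping.single (i, j) 1 + Poly_Mapping.single (i', j') 1)) \<Longrightarrow>
      P (s + (Poly_Mapping.single (i, j') 1 + Poly_Mapping.single (i', j) 1))"
  shows "P p"
proof -
  \<comment> \<open>A potential giving \<open>x_ij\<close> the cost \<open>i * (n - j)\<close>: an
    exchange lowers it by \<open>(i' - i) * (j' - j)\<close>, which is positive.\<close>
  define \<mu> where "\<mu> p = (\<Sum>x\<in>{1..m} \<times> {1..n}. Poly_Mapping.lookup p x * (fst x * (n - snd x)))" for p :: monomial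
  have \<mu>_add: "\<mu> (p + p') = \<mu> p + \<mu> p'" for p p'
    by (simp add: \<mu>_def lookup_add sum.distrib add_mult_distrib)
  have \<mu>_single: "\<mu> (Poly_Mapping.single (i, j) 1) = i * (n - j)" if "i \<in> {1..m}" "j \<in> {1..n}" for i j
  proof -
    have "\<mu> (Poly_Mapping.single (i, j) 1) = (\<Sum>x\<in>{1..m} \<times> {1..n}. if x = (i, j) then i * (n - j) else 0)"
      unfolding \<mu>_def by (rule sum.cong) (auto simp: lookup_single when_def)
    then show ?thesis using that by (simp add: sum.delta)
  qed
  show ?thesis using \<open>p \<in> monomials m n\<close>
  proof (induction "\<mu> p" arbitrary: p rule: less_induct)
    case less
    show ?case
    proof (cases "staircase m n p")
      case False
      then obtain i i' j j' where ij: "i \<in> {1..m}" "i' \<in> {1..m}" "j \<in> {1..n}" "j' \<in> {1..n}" "i < i'" "j < j'"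
        and pos: "Poly_Mapping.lookup p (i, j') \<noteq> 0" "Poly_Mapping.lookup p (i', j) \<noteq> 0"
        using less.prems unfolding staircase_def by blast
      obtain t where t: "t \<in> monomials m n" "p = t + Poly_Mapping.single (i, j') 1"
        using monomials_decomp[OF less.prems, of 1 "(i, j')"] pos by auto
      have "1 \<le> Poly_Mapping.lookup t (i', j)"
        using t pos ij by (simp add: lookup_add lookup_single)
      then obtain s where s: "s \<in> monomials m n" "t = s + Poly_Mapping.single (i', j) 1"
        using monomials_decomp[OF t(1)] by blast
      have p: "p = s + (Poly_Mapping.single (i, j') 1 + Poly_Mapping.single (i', j) 1)"
        using s t by (simp add: ac_simps)
      have "i * (n - j) + i' * (n - j') < i * (n - j') + i' * (n - j)"
      proof -
        obtain a b c where "i' = i + Suc a" "j' = j + Suc b" "n = j' + c"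
          using ij by (metis less_iff_Suc_add add_Suc_right atLeastAtMost_iff le_iff_add)
        then show ?thesis by (simp add: algebra_simps)
      qed
      then have "\<mu> (s + (Poly_Mapping.single (i, j) 1 + Poly_Mapping.single (i', j') 1)) < \<mu> p"
        unfolding p \<mu>_add using ij by (simp only: \<mu>_single add_less_cancel_left)
      from exchange[OF s(1) ij less.hyps[OF this]] show ?thesis
        unfolding p using s(1) ij by blast
    qed (rule staircase)
  qed
qed

text \<open>In a staircase matrix the sum of each upper left block is the minimum of the
  corresponding partial sums of row sums and of column sums. The weight thus fixes all block sums,
  and these fix the entries.\<close>

lemma staircase_weight_inj:
  assumes p: "staircase m n p" and p': "staircase m n p'" and w: "weight m n p = weight m n p'"
  shows "p = p'"
proof -
  define S where "S p a b = (\<Sum>i=1..a. \<Sum>j=1..b. Poly_Mapping.lookup p (i, j))" for p :: monomial and a b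
  have S_min: "S p a b = min (\<Sum>i=1..a. row_sum n p i) (\<Sum>j=1..b. col_sum m p j)"
    if "staircase m n p" "a \<le> m" "b \<le> n" for p a b
  proof -
    have split: "(\<Sum>i=1..l. f i) = (\<Sum>i=1..k. f i) + (\<Sum>i=Suc k..l. f i)" if "k \<le> l" for f :: "nat \<Rightarrow> nat" and k l
      using sum.ub_add_nat[of 1 k f "l - k"] that by simp
    have 1: "(\<Sum>i=1..a. row_sum n p i) = S p a b + (\<Sum>i=1..a. \<Sum>j=Suc b..n. Poly_Mapping.lookup p (i, j))"
      unfolding S_def row_sum_def split[OF \<open>b \<le> n\<close>] by (rule sum.distrib)
    have "(\<Sum>j=1..b. col_sum m p j) = (\<Sum>j=1..b. \<Sum>i=1..a. Poly_Mapping.lookup p (i, j))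
        + (\<Sum>j=1..b. \<Sum>i=Suc a..m. Poly_Mapping.lookup p (i, j))"
      unfolding col_sum_def split[OF \<open>a \<le> m\<close>] by (rule sum.distrib)
    also have "(\<Sum>j=1..b. \<Sum>i=1..a. Poly_Mapping.lookup p (i, j)) = S p a b"
      unfolding S_def by (rule sum.swap)
    finally have 2: "(\<Sum>j=1..b. col_sum m p j) = S p a b + (\<Sum>j=1..b. \<Sum>i=Suc a..m. Poly_Mapping.lookup p (i, j))" .
    \<comment> \<open>The two off-diagonal blocks cannot both meet the support of a staircase monomial.\<close>
    have "(\<Sum>i=1..a. \<Sum>j=Suc b..n. Poly_Mapping.lookup p (i, j)) = 0
      \<or> (\<Sum>j=1..b. \<Sum>i=Suc a..m. Poly_Mapping.lookup p (i, j)) = 0"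
    proof (rule disjCI)
      assume "(\<Sum>j=1..b. \<Sum>i=Suc a..m. Poly_Mapping.lookup p (i, j)) \<noteq> 0"
      then obtain i j where ij: "j \<in> {1..b}" "i \<in> {Suc a..m}" "Poly_Mapping.lookup p (i, j) > 0"
        by (auto elim!: sum.not_neutral_contains_not_neutral)
      have "Poly_Mapping.lookup p (i', j') = 0" if "i' \<in> {1..a}" "j' \<in> {Suc b..n}" for i' j'
      proof -
        have "i \<in> {1..m}" "j \<in> {1..n}" "i' \<in> {1..m}" "j' \<in> {1..n}" "i' < i" "j < j'"
          using ij that \<open>a \<le> m\<close> \<open>b \<le> n\<close> by auto
        then show ?thesis using ij(3) \<open>staircase m n p\<close> unfolding staircase_def by blast
      qed
      then show "(\<Sum>i=1..a. \<Sum>j=Suc b..n. Poly_Mapping.lookup p (i, j)) = 0" by simp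
    qed
    then show ?thesis using 1 2 by auto
  qed
  have S_eq: "S p a b = S p' a b" if "a \<le> m" "b \<le> n" for a b
  proof -
    have "(\<Sum>i=1..a. row_sum n p i) = (\<Sum>i=1..a. row_sum n p' i)"
      "(\<Sum>j=1..b. col_sum m p j) = (\<Sum>j=1..b. col_sum m p' j)"
      using w that by (auto simp: weight_eq_iff intro!: sum.cong)
    then show ?thesis using S_min[OF p that] S_min[OF p' that] by simp
  qed
  \<comment> \<open>The entry is a mixed second difference of block sums, written additively to
    avoid truncated subtraction.\<close>
  have S_Suc: "S p (Suc a) (Suc b) + S p a b = S p a (Suc b) + S p (Suc a) b + Poly_Mapping.lookup p (Suc a, Suc b)"
    for p a b
    by (simp add: S_def)
  show ?thesis
  proof (rule poly_mapping_eqI)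
    fix x
    show "Poly_Mapping.lookup p x = Poly_Mapping.lookup p' x"
    proof (cases "x \<in> {1..m} \<times> {1..n}")
      case True
      then obtain a b where "x = (Suc a, Suc b)" "Suc a \<le> m" "Suc b \<le> n"
        by (cases x) (auto simp: Suc_le_eq gr0_conv_Suc dest!: Suc_le_D)
      then show ?thesis
        using S_Suc[of p a b] S_Suc[of p' a b] S_eq[of a b] S_eq[of "Suc a" b] S_eq[of a "Suc b"] S_eq[of "Suc a" "Suc b"]
        by simp
    next
      case False
      then show ?thesis using p p' monomials_lookup_eq_0 unfolding staircase_def by metis
    qed
  qed
qed

lemma sum_list_weight: "sum_list (fst (weight m n p)) = sum_list (snd (weight m n p))"
proof -
  have *: "sum_list (map f [1..<Suc k]) = (\<Sum>i=1..k. f i)" for f :: "nat \<Rightarrow> nat" and k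
    by (simp only: sum_set_upt_conv_sum_list_nat[symmetric] set_upt atLeastLessThanSuc_atLeastAtMost)
  show ?thesis unfolding weight_def fst_conv snd_conv * row_sum_def col_sum_def by (rule sum.swap)
qed

lemma weight_add_single:
  assumes "i < m" "j < n" "weight m n p = (r, c)"
  shows "weight m n (p + Poly_Mapping.single (Suc i, Suc j) a) = (r[i := r ! i + a], c[j := c ! j + a])"
  using assms
  by (auto simp: weight_def row_sum_add col_sum_add row_sum_single col_sum_single
      intro!: nth_equalityI simp: nth_list_update simp del: upt_Suc)

text \<open>Greedy filling: while the common sum is positive, some row and some column still have
  positive demand, and one factor \<open>x_ij\<close> there reduces both.\<close>

lemma ex_monomial_weight:
  assumes "length r = m" "length c = n" "sum_list r = sum_list c"
  shows "\<exists>p\<in>monomials m n. weight m n p = (r, c)"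
  using assms
proof (induction "sum_list r" arbitrary: r c)
  case 0
  then have "r = replicate m 0" "c = replicate n 0"
    by (metis replicate_eqI sum_list_eq_0_iff)+
  then have "weight m n 0 = (r, c)"
    by (auto simp: weight_def intro!: nth_equalityI simp del: upt_Suc)
  then show ?case by (intro bexI[of _ 0]) auto
next
  case (Suc d)
  have "\<exists>i<length xs. 0 < xs ! i" if "sum_list xs = Suc d" for xs :: "nat list"
    using that by (metis in_set_conv_nth neq0_conv sum_list_eq_0_iff nat.distinct(1))
  then obtain i j where ij: "i < m" "0 < r ! i" "j < n" "0 < c ! j"
    using Suc.hyps(2) Suc.prems by metis
  let ?r = "r[i := r ! i - 1]" and ?c = "c[j := c ! j - 1]"
  have "sum_list ?r = d" "sum_list ?c = d"
    using ij Suc.hyps(2) Suc.prems elem_le_sum_list[of i r] elem_le_sum_list[of j c]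
    by (auto simp: sum_list_update)
  then obtain p where "p \<in> monomials m n" "weight m n p = (?r, ?c)"
    using Suc.hyps(1)[of ?r ?c] Suc.prems by auto
  moreover have "Poly_Mapping.single (Suc i, Suc j) 1 \<in> monomials m n"
    using ij by (intro monomials_single) auto
  ultimately show ?case
    using weight_add_single[of i m j n p ?r ?c 1] ij Suc.prems
    by (intro bexI[of _ "p + Poly_Mapping.single (Suc i, Suc j) 1"] monomials_add) auto
qed

text \<open>Straightening keeps the weight, by \<open>weight_exchange\<close>.\<close>

lemma ex_staircase_weight:
  assumes "p \<in> monomials m n"
  shows "\<exists>p'. staircase m n p' \<and> weight m n p' = weight m n p"
  using assms
proof (induction p rule: exchange_induct)
  case (exchange s i i' j j')
  then show ?case by (metis weight_exchange)
qed auto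

lemma weight_image_staircase:
  "weight m n ` {p. staircase m n p} = {(r, c). length r = m \<and> length c = n \<and> sum_list r = sum_list c}"
  (is "?L = ?R")
proof
  show "?L \<subseteq> ?R"
  proof
    fix w assume "w \<in> ?L"
    then obtain p where "w = weight m n p" by auto
    then show "w \<in> ?R" using sum_list_weight[of m n p] by (auto simp: weight_def)
  qed
  show "?R \<subseteq> ?L"
  proof clarify
    fix r c :: "nat list" assume "m = length r" "n = length c" "sum_list r = sum_list c"
    then obtain p where "p \<in> monomials m n" "weight m n p = (r, c)"
      using ex_monomial_weight by blast
    then show "(r, c) \<in> weight (length r) (length c) ` {p. staircase (length r) (length c) p}"
      using ex_staircase_weight \<open>m = _\<close> \<open>n = _\<close> by (metis image_eqI mem_Collect_eq)
  qed
qed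

text \<open>Existence and uniqueness make \<open>weight\<close> a bijection, which turns counts of
  staircase monomials into counts of pairs of vectors.\<close>

lemma card_staircase_weight:
  "card {p. staircase m n p \<and> weight m n p \<in> W}
    = card {(r, c). length r = m \<and> length c = n \<and> sum_list r = sum_list c \<and> (r, c) \<in> W}"
proof -
  let ?S = "{p. staircase m n p \<and> weight m n p \<in> W}"
  have "weight m n ` ?S = weight m n ` {p. staircase m n p} \<inter> W" by auto
  also have "\<dots> = {(r, c). length r = m \<and> length c = n \<and> sum_list r = sum_list c \<and> (r, c) \<in> W}"
    unfolding weight_image_staircase by auto
  finally have "bij_betw (weight m n) ?S {(r, c). length r = m \<and> length c = n \<and> sum_list r = sum_list c \<and> (r, c) \<in> W}"
    using staircase_weight_inj by (auto simp: bij_betw_def inj_on_def)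
  then show ?thesis by (rule bij_betw_same_card)
qed

section \<open>The counts N and M in terms of weights\<close>

lemma fst_weight_tuples: "fst (weight m n p) \<in> tuples m q \<longleftrightarrow> (\<forall>i\<in>{1..m}. row_sum n p i < q)"
  by (auto simp: weight_def tuples_def simp del: upt_Suc)

lemma snd_weight_tuples: "snd (weight m n p) \<in> tuples n q \<longleftrightarrow> (\<forall>j\<in>{1..n}. col_sum m p j < q)"
  by (auto simp: weight_def tuples_def simp del: upt_Suc)

text \<open>The weights surviving modulo \<open>q\<close>-th powers: for lists of lengths
  \<open>m\<close> and \<open>n\<close>, \<open>y^r z^c\<close> is divisible by some
  \<open>(y_i z_j)^q\<close> exactly when both \<open>r\<close> and \<open>c\<close> leave their
  boxes.\<close>

definition small :: "nat \<Rightarrow> nat \<Rightarrow> nat \<Rightarrow> (nat list \<times> nat list) set" where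
  "small m n q = {(r, c). r \<in> tuples m q \<or> c \<in> tuples n q}"

lemma N_count_eq:
  "N_count q m n (\<lambda>_. \<infinity>) (\<lambda>_. \<infinity>) = card {p. staircase m n p \<and> weight m n p \<in> small m n q}"
  by (simp add: N_count_def small_def case_prod_unfold fst_weight_tuples snd_weight_tuples)

lemma N_count_bounded_eq:
  assumes "q > 0"
  shows "N_count q m n (\<lambda>_. \<infinity>) (\<lambda>_. enat (q - 1))
    = card {p. staircase m n p \<and> weight m n p \<in> {(r, c). c \<in> tuples n q}}"
proof -
  \<comment> \<open>Positivity of \<open>q\<close> turns the truncated bound into a strict one; the
    column bound then is the second alternative of condition (ii).\<close>
  have "k \<le> q - 1 \<longleftrightarrow> k < q" for k using assms by auto
  then show ?thesis
    by (auto simp: N_count_def case_prod_unfold snd_weight_tuples intro!: arg_cong[of _ _ card])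
qed

lemma M_count_eq:
  assumes "q > 0"
  shows "M_count q m n (\<lambda>_. enat (q - 1)) (\<lambda>_. enat (q - 1))
    = card {p. staircase m n p \<and> weight m n p \<in> {(r, c). r \<in> tuples m q \<and> c \<notin> tuples n q}}"
proof -
  have "k \<le> q - 1 \<longleftrightarrow> k < q" "q - 1 < k \<longleftrightarrow> \<not> k < q" for k using assms by auto
  then show ?thesis
    by (simp add: M_count_def case_prod_unfold fst_weight_tuples snd_weight_tuples)
qed

text \<open>The vector inside its box takes finitely many values and determines the common sum,
  which leaves finitely many choices for the other vector.\<close>

lemma finite_bounded_staircase: "finite {p. staircase m n p \<and> weight m n p \<in> small m n q}"
proof (rule inj_on_finite)
  let ?T = "{(r, c). length r = m \<and> length c = n \<and> sum_list r = sum_list c \<and> (r, c) \<in> small m n q}"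
  show "inj_on (weight m n) {p. staircase m n p \<and> weight m n p \<in> small m n q}"
    using staircase_weight_inj by (auto simp: inj_on_def)
  show "weight m n ` {p. staircase m n p \<and> weight m n p \<in> small m n q} \<subseteq> ?T"
    using weight_image_staircase[of m n] by auto
  have "?T \<subseteq> (\<Union>r\<in>tuples m q. {r} \<times> {c. length c = n \<and> sum_list c = sum_list r})
     \<union> (\<Union>c\<in>tuples n q. {r. length r = m \<and> sum_list r = sum_list c} \<times> {c})"
    by (auto simp: small_def)
  then show "finite ?T"
    by (rule finite_subset) (auto simp: finite_sum_list_eq)
qed

lemma N_count_split:
  assumes "q > 0"
  shows "N_count q m n (\<lambda>_. \<infinity>) (\<lambda>_. \<infinity>) = N_count q m n (\<lambda>_. \<infinity>) (\<lambda>_. enat (q - 1))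
             + M_count q m n (\<lambda>_. enat (q - 1)) (\<lambda>_. enat (q - 1))"
proof -
  let ?A = "{p. staircase m n p \<and> weight m n p \<in> {(r, c). c \<in> tuples n q}}"
  let ?B = "{p. staircase m n p \<and> weight m n p \<in> {(r, c). r \<in> tuples m q \<and> c \<notin> tuples n q}}"
  \<comment> \<open>Split by whether the column sums lie in their box; if they do not, the row sums
    must.\<close>
  have eq: "{p. staircase m n p \<and> weight m n p \<in> small m n q} = ?A \<union> ?B"
    by (auto simp: small_def)
  then have "finite (?A \<union> ?B)" using finite_bounded_staircase[of m n q] by simp
  then show ?thesis
    unfolding N_count_eq N_count_bounded_eq[OF assms] M_count_eq[OF assms] eq
    by (intro card_Un_disjoint) auto
qed

lemma N_count_bounded_formula:
  assumes "m > 0" "n > 0" "q > 0"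
  shows "int (N_count q m n (\<lambda>_. \<infinity>) (\<lambda>_. enat (q - 1)))
    = (\<Sum>i=1..n. (-1) ^ (n - i) * int (n choose i) * binom (int i * int q + int m - 1) (m + n - 1))"
proof -
  have "{(r, c). length r = m \<and> length c = n \<and> sum_list r = sum_list c \<and> (r, c) \<in> {(r, c). c \<in> tuples n q}}
    = {(r, c). length r = m \<and> c \<in> tuples n q \<and> sum_list r = sum_list c}"
    by (auto simp: tuples_def)
  then show ?thesis
    unfolding N_count_bounded_eq[OF assms(3)] card_staircase_weight
    using card_unbounded_small[OF assms(1,2), of q] by simp
qed

lemma M_count_formula:
  assumes "m > 0" "n > 0" "q > 0"
  shows "int (M_count q m n (\<lambda>_. enat (q - 1)) (\<lambda>_. enat (q - 1)))
    = (\<Sum>i=1..n. \<Sum>j=1..m. (-1) ^ (m - j + i - 1) * int (n choose i) * int (m choose j)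
                * binom (int j * int q - int i * int q + int n - 1) (m + n - 1))"
proof -
  have "{(r, c). length r = m \<and> length c = n \<and> sum_list r = sum_list c \<and> (r, c) \<in> {(r, c). r \<in> tuples m q \<and> c \<notin> tuples n q}}
    = {(r, c). r \<in> tuples m q \<and> length c = n \<and> c \<notin> tuples n q \<and> sum_list r = sum_list c}"
    by (auto simp: tuples_def)
  then show ?thesis
    unfolding M_count_eq[OF assms(3)] card_staircase_weight
    using card_small_unbounded[OF assms(2,1), of q] by simp
qed

section \<open>The quotient of the polynomial ring\<close>

lemma keys_uminus [simp]: "Poly_Mapping.keys (- f) = Poly_Mapping.keys (f :: 'a \<Rightarrow>\<^sub>0 'b::ab_group_add)"
  by (auto simp: in_keys_iff)

lemma poly_ring_simps [simp]:
  "\<one>\<^bsub>poly_ring m n\<^esub> = 1" "\<zero>\<^bsub>poly_ring m n\<^esub> = 0"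
  "f \<otimes>\<^bsub>poly_ring m n\<^esub> g = f * g" "f \<oplus>\<^bsub>poly_ring m n\<^esub> g = f + g"
  "f \<in> carrier (poly_ring m n) \<longleftrightarrow> Poly_Mapping.keys f \<subseteq> monomials m n"
  by (simp_all add: poly_ring_def)

lemma keys_mult_monomials:
  assumes "Poly_Mapping.keys f \<subseteq> monomials m n" "Poly_Mapping.keys g \<subseteq> monomials m n"
  shows "Poly_Mapping.keys (f * g) \<subseteq> monomials m n"
  using keys_mult[of f g] assms by blast

lemma keys_add_monomials:
  assumes "Poly_Mapping.keys f \<subseteq> monomials m n" "Poly_Mapping.keys g \<subseteq> monomials m n"
  shows "Poly_Mapping.keys (f + g) \<subseteq> monomials m n"
  using keys_add[of f g] assms by blast

lemma cring_poly_ring: "cring (poly_ring m n :: 'k::field polynomial ring)"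
proof (rule cringI)
  show "abelian_group (poly_ring m n :: 'k polynomial ring)"
  proof (rule abelian_groupI)
    fix f :: "'k polynomial" assume "f \<in> carrier (poly_ring m n)"
    then show "\<exists>g\<in>carrier (poly_ring m n). g \<oplus>\<^bsub>poly_ring m n\<^esub> f = \<zero>\<^bsub>poly_ring m n\<^esub>"
      by (intro bexI[of _ "- f"]) auto
  qed (auto simp: algebra_simps keys_add_monomials)
  show "Group.comm_monoid (poly_ring m n :: 'k polynomial ring)"
    by (rule comm_monoidI) (auto simp: algebra_simps keys_mult_monomials)
qed (auto simp: algebra_simps)

lemma poly_ring_pow: "f [^]\<^bsub>poly_ring m n\<^esub> (k::nat) = f ^ k"
  by (induction k) (simp_all add: nat_pow_def mult.commute)

lemma ideal_poly_ringD:
  assumes "ideal K (poly_ring m n)"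
  shows "f \<in> K \<Longrightarrow> Poly_Mapping.keys f \<subseteq> monomials m n"
    and "0 \<in> K"
    and "f \<in> K \<Longrightarrow> g \<in> K \<Longrightarrow> f + g \<in> K"
    and "f \<in> K \<Longrightarrow> Poly_Mapping.keys g \<subseteq> monomials m n \<Longrightarrow> g * f \<in> K"
proof -
  interpret ideal K "poly_ring m n" by fact
  show "f \<in> K \<Longrightarrow> Poly_Mapping.keys f \<subseteq> monomials m n" using a_Hcarr by auto
  show "0 \<in> K" using additive_subgroup.zero_closed[OF is_additive_subgroup] by simp
  show "f \<in> K \<Longrightarrow> g \<in> K \<Longrightarrow> f + g \<in> K" using additive_subgroup.a_closed[OF is_additive_subgroup, of f g] by simp
  show "f \<in> K \<Longrightarrow> Poly_Mapping.keys g \<subseteq> monomials m n \<Longrightarrow> g * f \<in> K" using I_l_closed[of f g] by simp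
qed

lemma ideal_poly_ring_uminus:
  assumes "ideal K (poly_ring m n)" "f \<in> K"
  shows "- f \<in> K"
  using ideal_poly_ringD(4)[OF assms, of "-1"] by simp

lemma ideal_poly_ring_diff:
  assumes "ideal K (poly_ring m n)" "f \<in> K" "g \<in> K"
  shows "f - g \<in> K"
  using ideal_poly_ringD(3)[OF assms(1,2) ideal_poly_ring_uminus[OF assms(1,3)]] by simp

section \<open>The ideal generated by the minors and the q-th powers\<close>

definition hk_ideal :: "nat \<Rightarrow> nat \<Rightarrow> nat \<Rightarrow> 'k::field polynomial set" where
  "hk_ideal m n q = I2 m n <+>\<^bsub>poly_ring m n\<^esub> Idl\<^bsub>poly_ring m n\<^esub> {x [^]\<^bsub>poly_ring m n\<^esub> q | x. x \<in> vars m n}"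

abbreviation mon :: "monomial \<Rightarrow> 'k::field polynomial" where
  "mon p \<equiv> Poly_Mapping.single p 1"

lemma var_power: "var i j ^ q = mon (Poly_Mapping.single (i, j) q)"
  by (induction q) (simp_all add: var_def mult_single single_add[symmetric])

lemma minors2_eq:
  "minors2 m n = {mon (Poly_Mapping.single (i, j) 1 + Poly_Mapping.single (i', j') 1)
      - mon (Poly_Mapping.single (i, j') 1 + Poly_Mapping.single (i', j) 1) | i i' j j'.
    i \<in> {1..m} \<and> i' \<in> {1..m} \<and> i < i' \<and> j \<in> {1..n} \<and> j' \<in> {1..n} \<and> j < j'}"
  by (simp add: minors2_def var_def mult_single)

lemma powers_eq: "{x [^]\<^bsub>poly_ring m n\<^esub> q | x. x \<in> vars m n}
    = {mon (Poly_Mapping.single (i, j) q) | i j. i \<in> {1..m} \<and> j \<in> {1..n}}"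
  unfolding vars_def poly_ring_pow by (auto simp: var_power[symmetric])

text \<open>A sum of two generated ideals is the least ideal containing both sets of generators.
  These four facts carry all later ideal-theoretic arguments.\<close>

lemma
  fixes m n q :: nat
  defines "J \<equiv> hk_ideal m n q :: 'a::field polynomial set"
  shows ideal_hk_ideal: "ideal J (poly_ring m n)"
    and minors2_hk_ideal: "minors2 m n \<subseteq> J"
    and powers_hk_ideal: "i \<in> {1..m} \<Longrightarrow> j \<in> {1..n} \<Longrightarrow> mon (Poly_Mapping.single (i, j) q) \<in> J"
    and hk_ideal_minimal: "ideal K (poly_ring m n) \<Longrightarrow> minors2 m n \<subseteq> K \<Longrightarrow>
       (\<And>i j. i \<in> {1..m} \<Longrightarrow> j \<in> {1..n} \<Longrightarrow> mon (Poly_Mapping.single (i, j) q) \<in> K) \<Longrightarrow> J \<subseteq> K"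
proof -
  interpret cring "poly_ring m n :: 'a polynomial ring" by (rule cring_poly_ring)
  let ?X = "{x [^]\<^bsub>poly_ring m n\<^esub> q | x. x \<in> vars m n}"
  let ?Y = "{mon (Poly_Mapping.single (i, j) q) | i j. i \<in> {1..m} \<and> j \<in> {1..n}} :: 'a polynomial set"
  have diff: "mon p - mon p' \<in> carrier (poly_ring m n :: 'a polynomial ring)"
    if "p \<in> monomials m n" "p' \<in> monomials m n" for p p'
    using keys_add_monomials[of "mon p" m n "- mon p'"] that by simp
  have 1: "minors2 m n \<subseteq> carrier (poly_ring m n :: 'a polynomial ring)"
  proof
    fix f :: "'a polynomial" assume "f \<in> minors2 m n"
    then show "f \<in> carrier (poly_ring m n)"
      unfolding minors2_eq by (elim CollectE exE conjE, hypsubst) (intro diff monomials_add monomials_single)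
  qed
  have 2: "?Y \<subseteq> carrier (poly_ring m n)"
    by (auto simp: monomials_single)
  note I1 = genideal_ideal[OF 1] and I2 = genideal_ideal[OF 2]
  have eq: "J = {f + g | f g. f \<in> Idl\<^bsub>poly_ring m n\<^esub> (minors2 m n) \<and> g \<in> Idl\<^bsub>poly_ring m n\<^esub> ?Y}"
    by (auto simp: J_def hk_ideal_def powers_eq I2_def set_add_def')
  show "ideal J (poly_ring m n)"
    unfolding J_def hk_ideal_def I2_def powers_eq by (rule add_ideals[OF I1 I2])
  show "minors2 m n \<subseteq> J"
    unfolding eq using genideal_self[OF 1] ideal_poly_ringD(2)[OF I2] by force
  show "mon (Poly_Mapping.single (i, j) q) \<in> J" if "i \<in> {1..m}" "j \<in> {1..n}" for i j
  proof -
    have "mon (Poly_Mapping.single (i, j) q) \<in> Idl\<^bsub>poly_ring m n\<^esub> ?Y"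
      using genideal_self[OF 2] that by blast
    then show ?thesis unfolding eq using ideal_poly_ringD(2)[OF I1] by force
  qed
  show "J \<subseteq> K" if K: "ideal K (poly_ring m n)" "minors2 m n \<subseteq> K"
     "\<And>i j. i \<in> {1..m} \<Longrightarrow> j \<in> {1..n} \<Longrightarrow> mon (Poly_Mapping.single (i, j) q) \<in> K" for K :: "'a polynomial set"
  proof -
    have "?Y \<subseteq> K" using K(3) by blast
    then have "Idl\<^bsub>poly_ring m n\<^esub> ?Y \<subseteq> K" by (rule genideal_minimal[OF K(1)])
    moreover have "Idl\<^bsub>poly_ring m n\<^esub> (minors2 m n) \<subseteq> K" by (rule genideal_minimal[OF K(1,2)])
    ultimately show ?thesis unfolding eq using ideal_poly_ringD(3)[OF K(1)] by blast
  qed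
qed

text \<open>The coefficient of the image of \<open>f\<close> in the Segre ring at \<open>y^r z^c\<close>, where \<open>w = (r, c)\<close>.\<close>

definition wcoeff :: "nat \<Rightarrow> nat \<Rightarrow> nat list \<times> nat list \<Rightarrow> 'k::field polynomial \<Rightarrow> 'k" where
  "wcoeff m n w f = (\<Sum>p | p \<in> Poly_Mapping.keys f \<and> weight m n p = w. Poly_Mapping.lookup f p)"

text \<open>Summing over a larger finite set allows polynomials with different supports to be
  compared term by term.\<close>

lemma wcoeff_superset:
  assumes "finite S" "Poly_Mapping.keys f \<subseteq> S"
  shows "wcoeff m n w f = (\<Sum>p\<in>S. if weight m n p = w then Poly_Mapping.lookup f p else 0)"
proof -
  have "wcoeff m n w f = (\<Sum>p\<in>Poly_Mapping.keys f. if weight m n p = w then Poly_Mapping.lookup f p else 0)"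
    unfolding wcoeff_def by (subst sum.inter_filter[symmetric]) (auto intro!: sum.cong)
  also have "\<dots> = (\<Sum>p\<in>S. if weight m n p = w then Poly_Mapping.lookup f p else 0)"
    using assms by (intro sum.mono_neutral_left) (auto simp: in_keys_iff)
  finally show ?thesis .
qed

lemma wcoeff_add: "wcoeff m n w (f + g) = wcoeff m n w f + wcoeff m n w g"
proof -
  let ?S = "Poly_Mapping.keys f \<union> Poly_Mapping.keys g"
  have "wcoeff m n w h = (\<Sum>p\<in>?S. if weight m n p = w then Poly_Mapping.lookup h p else 0)"
    if "Poly_Mapping.keys h \<subseteq> ?S" for h
    using that by (intro wcoeff_superset) auto
  from this[of f] this[of g] this[of "f + g"] show ?thesis
    using keys_add[of f g] by (auto simp: lookup_add sum.distrib[symmetric] intro!: sum.cong)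
qed

lemma wcoeff_0 [simp]: "wcoeff m n w 0 = 0"
  by (simp add: wcoeff_def)

lemma wcoeff_uminus: "wcoeff m n w (- f) = - wcoeff m n w f"
  by (simp add: wcoeff_def sum_negf)

lemma wcoeff_single: "wcoeff m n w (Poly_Mapping.single p a) = (if weight m n p = w then a else 0)"
  using wcoeff_superset[of "{p}" "Poly_Mapping.single p a" m n w] by simp

lemma wcoeff_sum: "wcoeff m n w (sum f A) = (\<Sum>x\<in>A. wcoeff m n w (f x))"
  by (induction A rule: infinite_finite_induct) (auto simp: wcoeff_add)

lemma poly_mapping_sum_single: "f = (\<Sum>p\<in>Poly_Mapping.keys f. Poly_Mapping.single p (Poly_Mapping.lookup f p))"
  by (rule poly_mapping_eqI)
     (simp add: lookup_sum lookup_single when_def sum.delta in_keys_iff)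

lemma wcoeff_mult:
  "wcoeff m n w (g * f) = (\<Sum>s\<in>Poly_Mapping.keys g. Poly_Mapping.lookup g s *
    (\<Sum>p\<in>Poly_Mapping.keys f. if weight m n (s + p) = w then Poly_Mapping.lookup f p else 0))"
proof -
  have "g * f = (\<Sum>s\<in>Poly_Mapping.keys g. \<Sum>p\<in>Poly_Mapping.keys f.
      Poly_Mapping.single (s + p) (Poly_Mapping.lookup g s * Poly_Mapping.lookup f p))"
    by (subst poly_mapping_sum_single[of g], subst poly_mapping_sum_single[of f])
       (simp add: sum_product mult_single)
  then show ?thesis
    by (simp add: wcoeff_sum wcoeff_single sum_distrib_left if_distrib cong: if_cong)
qed

section \<open>Ideals cut out by vanishing Segre coefficients\<close>

definition vanishing :: "nat \<Rightarrow> nat \<Rightarrow> (nat list \<times> nat list) set \<Rightarrow> 'k::field polynomial set" where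
  "vanishing m n W = {f. Poly_Mapping.keys f \<subseteq> monomials m n \<and> (\<forall>w\<in>W. wcoeff m n w f = 0)}"

text \<open>The coefficient of \<open>g * f\<close> at \<open>w\<close> involves only coefficients
  of \<open>f\<close> at weights dividing \<open>w\<close>; if \<open>W\<close> is closed under
  divisors, these all vanish.\<close>

lemma ideal_vanishing:
  assumes down: "\<And>s p. s \<in> monomials m n \<Longrightarrow> p \<in> monomials m n \<Longrightarrow> weight m n (s + p) \<in> W \<Longrightarrow> weight m n p \<in> W"
  shows "ideal (vanishing m n W :: 'k::field polynomial set) (poly_ring m n)"
proof -
  interpret cring "poly_ring m n :: 'k polynomial ring" by (rule cring_poly_ring)
  have mult: "g * f \<in> vanishing m n W"
    if f: "f \<in> vanishing m n W" and g: "Poly_Mapping.keys g \<subseteq> monomials m n" for f g :: "'k polynomial"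
  proof -
    \<comment> \<open>For fixed \<open>s\<close>, all \<open>p\<close> that contribute share one
      weight by \<open>weight_add_cancel\<close>, so the sum is empty or a single coefficient
      \<open>wcoeff\<close> of \<open>f\<close>.\<close>
    have "(\<Sum>p\<in>Poly_Mapping.keys f. if weight m n (s + p) = w then Poly_Mapping.lookup f p else 0) = 0"
      if "s \<in> Poly_Mapping.keys g" "w \<in> W" for s w
    proof (cases "\<exists>p\<in>Poly_Mapping.keys f. weight m n (s + p) = w")
      case True
      then obtain p where p: "p \<in> Poly_Mapping.keys f" "weight m n (s + p) = w" by blast
      then have "weight m n p \<in> W" using down that f g by (auto simp: vanishing_def)
      then have "wcoeff m n (weight m n p) f = 0" using f by (simp add: vanishing_def)
      then show ?thesis
        using wcoeff_superset[of "Poly_Mapping.keys f" f m n "weight m n p"]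
        by (simp add: p(2)[symmetric] weight_add_cancel)
    qed (auto intro!: sum.neutral)
    then show ?thesis
      using f g by (auto simp: vanishing_def wcoeff_mult keys_mult_monomials)
  qed
  show ?thesis
  proof (rule idealI)
    show "ring (poly_ring m n :: 'k polynomial ring)" by (rule ring_axioms)
    show "subgroup (vanishing m n W :: 'k polynomial set) (add_monoid (poly_ring m n))"
    proof (rule add.subgroupI)
      show "vanishing m n W \<noteq> ({} :: 'k polynomial set)"
        by (auto simp: vanishing_def intro: exI[of _ 0])
      show "\<ominus>\<^bsub>poly_ring m n\<^esub> f \<in> vanishing m n W" if "f \<in> vanishing m n W" for f :: "'k polynomial"
      proof -
        have "\<ominus>\<^bsub>poly_ring m n\<^esub> f = - f"
          using that by (intro minus_equality) (auto simp: vanishing_def)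
        then show ?thesis using that by (simp add: vanishing_def wcoeff_uminus)
      qed
    qed (auto simp: vanishing_def wcoeff_add keys_add_monomials)
    show "g \<otimes>\<^bsub>poly_ring m n\<^esub> f \<in> vanishing m n W" "f \<otimes>\<^bsub>poly_ring m n\<^esub> g \<in> vanishing m n W"
      if "f \<in> vanishing m n W" "g \<in> carrier (poly_ring m n)" for f g :: "'k polynomial"
      using mult[of f g] that by (auto simp: mult.commute)
  qed
qed

lemma small_down_closed: "weight m n (s + p) \<in> small m n q \<Longrightarrow> weight m n p \<in> small m n q"
  by (auto simp: small_def case_prod_unfold fst_weight_tuples snd_weight_tuples row_sum_add col_sum_add
      intro: le_less_trans[OF le_add2])

text \<open>It suffices to check generators: the two terms of a minor cancel in the Segre ring, and
  \<open>x_ij^q\<close> has a row sum and a column sum equal to \<open>q\<close>, so its weight is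
  outside \<open>W\<close>.\<close>

lemma hk_ideal_vanishing:
  assumes "W \<subseteq> small m n q"
    and "ideal (vanishing m n W :: 'k::field polynomial set) (poly_ring m n)"
  shows "hk_ideal m n q \<subseteq> (vanishing m n W :: 'k polynomial set)"
proof (rule hk_ideal_minimal)
  show "minors2 m n \<subseteq> (vanishing m n W :: 'k polynomial set)"
  proof
    fix f :: "'k polynomial" assume f: "f \<in> minors2 m n"
    have "f \<in> hk_ideal m n q" using f minors2_hk_ideal by blast
    then have "Poly_Mapping.keys f \<subseteq> monomials m n" by (rule ideal_poly_ringD(1)[OF ideal_hk_ideal])
    moreover have "wcoeff m n w f = 0" for w
    proof -
      obtain p p' where "f = mon p + - mon p'" "weight m n p = weight m n p'"
        using f weight_exchange[of _ m _ _ n _ 0] by (auto simp: minors2_eq)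
      then show ?thesis by (simp only: wcoeff_add wcoeff_uminus wcoeff_single) simp
    qed
    ultimately show "f \<in> vanishing m n W" by (simp add: vanishing_def)
  qed
  fix i j assume "i \<in> {1..m}" "j \<in> {1..n}"
  then have "weight m n (Poly_Mapping.single (i, j) q) \<notin> small m n q"
    by (auto simp: small_def case_prod_unfold fst_weight_tuples snd_weight_tuples row_sum_single col_sum_single)
  then show "mon (Poly_Mapping.single (i, j) q) \<in> (vanishing m n W :: 'k polynomial set)"
    using assms(1) \<open>i \<in> _\<close> \<open>j \<in> _\<close> by (auto simp: vanishing_def wcoeff_single monomials_single)
qed fact

section \<open>Upper bound: small staircase monomials span the quotient\<close>

lemma mon_cong_staircase:
  assumes "p \<in> monomials m n"
  shows "\<exists>p'. staircase m n p' \<and> weight m n p' = weight m n p \<and> mon p - mon p' \<in> (hk_ideal m n q :: 'k::field polynomial set)"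
  using assms
proof (induction p rule: exchange_induct)
  case (staircase p)
  then show ?case using ideal_poly_ringD(2)[OF ideal_hk_ideal] by (intro exI[of _ p]) auto
next
  case (exchange s i i' j j')
  let ?p = "Poly_Mapping.single (i, j) 1 + Poly_Mapping.single (i', j') (1::nat)"
  let ?p' = "Poly_Mapping.single (i, j') 1 + Poly_Mapping.single (i', j) (1::nat)"
  obtain p' where p': "staircase m n p'" "weight m n p' = weight m n (s + ?p)" "mon (s + ?p) - mon p' \<in> (hk_ideal m n q :: 'k polynomial set)"
    using exchange.IH by blast
  \<comment> \<open>An exchange changes the monomial by \<open>mon s\<close> times a minor, so
    straightening preserves the residue class.\<close>
  have "mon ?p - mon ?p' \<in> (hk_ideal m n q :: 'k polynomial set)"
    using minors2_hk_ideal exchange.hyps by (fastforce simp: minors2_eq)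
  then have "mon s * (mon ?p - mon ?p') \<in> (hk_ideal m n q :: 'k polynomial set)"
    using exchange.hyps(1) by (intro ideal_poly_ringD(4)[OF ideal_hk_ideal]) auto
  from ideal_poly_ring_diff[OF ideal_hk_ideal p'(3) this]
  have "mon (s + ?p') - mon p' \<in> (hk_ideal m n q :: 'k polynomial set)"
    by (simp add: algebra_simps mult_single)
  then show ?case using p' weight_exchange[OF exchange.hyps(2-5)] by auto
qed

text \<open>The monomial \<open>p\<close> may fail to be divisible by any \<open>x_ij^q\<close>, but
  another monomial of the same weight is: take \<open>q\<close> off a large row sum and a large
  column sum, realise the rest by some \<open>s\<close>, and multiply by \<open>x_ij^q\<close>. Its
  straightening is \<open>p\<close>.\<close>

lemma mon_large_in_hk_ideal:
  assumes "staircase m n p" "weight m n p \<notin> small m n q"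
  shows "mon p \<in> (hk_ideal m n q :: 'k::field polynomial set)"
proof -
  let ?r = "map (row_sum n p) [1..<Suc m]" and ?c = "map (col_sum m p) [1..<Suc n]"
  have w: "weight m n p = (?r, ?c)" "length ?r = m" "length ?c = n" by (simp_all add: weight_def)
  have "\<exists>x\<in>set ?r. q \<le> x" "\<exists>x\<in>set ?c. q \<le> x"
    using assms(2) w(2,3) unfolding w(1) small_def tuples_def by (auto simp: not_less simp del: upt_Suc)
  then obtain i j where ij: "i < m" "j < n" "q \<le> ?r ! i" "q \<le> ?c ! j"
    using w(2,3) by (metis in_set_conv_nth)
  let ?r' = "?r[i := ?r ! i - q]" and ?c' = "?c[j := ?c ! j - q]"
  have "sum_list ?r' = sum_list ?c'"
    using ij sum_list_weight[of m n p] w elem_le_sum_list[of i ?r] elem_le_sum_list[of j ?c]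
    by (simp add: sum_list_update del: upt_Suc)
  then obtain s where s: "s \<in> monomials m n" "weight m n s = (?r', ?c')"
    using ex_monomial_weight[of ?r' m ?c' n] w by auto
  let ?e = "Poly_Mapping.single (Suc i, Suc j) q"
  have "weight m n (s + ?e) = weight m n p"
  proof -
    have "?r'[i := ?r' ! i + q] = ?r" "?c'[j := ?c' ! j + q] = ?c"
      using ij w(2,3) by (auto simp: nth_list_update intro!: nth_equalityI simp del: upt_Suc)
    then show ?thesis unfolding weight_add_single[OF ij(1,2) s(2)] by (simp only: w(1))
  qed
  moreover have "?e \<in> monomials m n" using ij by (intro monomials_single) auto
  ultimately obtain p' where "staircase m n p'" "weight m n p' = weight m n p"
    "mon (s + ?e) - mon p' \<in> (hk_ideal m n q :: 'k polynomial set)"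
    using mon_cong_staircase[OF monomials_add[OF s(1)]] by metis
  \<comment> \<open>Uniqueness of the staircase monomial of a given weight identifies the
    straightened form.\<close>
  moreover from this have "p' = p" using staircase_weight_inj assms by blast
  moreover have "mon s * mon ?e \<in> (hk_ideal m n q :: 'k polynomial set)"
    using s ij by (intro ideal_poly_ringD(4)[OF ideal_hk_ideal] powers_hk_ideal) auto
  then have "mon (s + ?e) \<in> (hk_ideal m n q :: 'k polynomial set)"
    by (simp add: mult_single)
  ultimately show ?thesis
    using ideal_poly_ring_diff[OF ideal_hk_ideal, of "mon (s + ?e)" m n q "mon (s + ?e) - mon p"] by simp
qed

text \<open>Scalars act as constant polynomials, so an ideal is a subspace by its closure under
  multiplication.\<close>

interpretation poly_vs: vector_space "\<lambda>c f. Poly_Mapping.single 0 c * (f :: 'k::field polynomial)"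
  by unfold_locales (simp_all add: algebra_simps single_add mult_single)

lemma cong_span_staircase:
  fixes f :: "'k::field polynomial"
  assumes "Poly_Mapping.keys f \<subseteq> monomials m n"
  shows "\<exists>g\<in>poly_vs.span (mon ` {p. staircase m n p \<and> weight m n p \<in> small m n q}). f - g \<in> hk_ideal m n q"
proof -
  let ?B = "{p. staircase m n p \<and> weight m n p \<in> small m n q}"
  let ?V = "poly_vs.span (mon ` ?B) :: 'k polynomial set"
  have mono: "\<exists>g\<in>?V. mon p - g \<in> hk_ideal m n q" if p: "p \<in> monomials m n" for p
  proof -
    obtain p' where p': "staircase m n p'" "weight m n p' = weight m n p" "mon p - mon p' \<in> (hk_ideal m n q :: 'k polynomial set)"
      using mon_cong_staircase[OF p] by blast
    show ?thesis
    proof (cases "weight m n p' \<in> small m n q")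
      case True
      then show ?thesis using p' by (intro bexI[of _ "mon p'"] poly_vs.span_base) auto
    next
      case False
      then have "mon p' \<in> (hk_ideal m n q :: 'k polynomial set)" using mon_large_in_hk_ideal p' by blast
      then have "mon p \<in> (hk_ideal m n q :: 'k polynomial set)"
        using ideal_poly_ringD(3)[OF ideal_hk_ideal p'(3)] by fastforce
      then show ?thesis using poly_vs.span_zero by (intro bexI[of _ 0]) auto
    qed
  qed
  \<comment> \<open>Linear extension from monomials, with coefficients \<open>a\<close> independent
    of \<open>f\<close> so that the induction can run over the index set alone.\<close>
  have "\<exists>g\<in>?V. (\<Sum>p\<in>S. Poly_Mapping.single p (a p)) - g \<in> hk_ideal m n q"
    if "finite S" "S \<subseteq> monomials m n" for S and a :: "monomial \<Rightarrow> 'k"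
    using that
  proof (induction S)
    case empty
    then show ?case using poly_vs.span_zero ideal_poly_ringD(2)[OF ideal_hk_ideal] by (intro bexI[of _ 0]) auto
  next
    case (insert p S)
    then obtain g h where gh: "g \<in> ?V" "(\<Sum>p\<in>S. Poly_Mapping.single p (a p)) - g \<in> hk_ideal m n q"
      "h \<in> ?V" "mon p - h \<in> hk_ideal m n q"
      using mono by blast
    have "Poly_Mapping.single 0 (a p) * (mon p - h) \<in> hk_ideal m n q"
      using gh(4) by (rule ideal_poly_ringD(4)[OF ideal_hk_ideal]) simp
    then have "Poly_Mapping.single p (a p) - Poly_Mapping.single 0 (a p) * h \<in> hk_ideal m n q"
      by (simp add: algebra_simps mult_single)
    from ideal_poly_ringD(3)[OF ideal_hk_ideal this gh(2)]
    have "(\<Sum>p\<in>insert p S. Poly_Mapping.single p (a p)) - (Poly_Mapping.single 0 (a p) * h + g) \<in> hk_ideal m n q"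
      using insert.hyps by (simp add: algebra_simps)
    then show ?case
      using gh by (intro bexI[of _ "Poly_Mapping.single 0 (a p) * h + g"] poly_vs.span_add poly_vs.span_scale)
  qed
  from this[OF finite_keys assms, of "Poly_Mapping.lookup f"] show ?thesis
    using poly_mapping_sum_single[of f] by simp
qed

text \<open>One vector of \<open>span T\<close> chosen at each step lies outside the previous
  subspace, hence outside the span of the earlier choices. The \<open>l\<close> vectors are
  independent, and the exchange bound applies.\<close>

lemma (in vector_space) chain_length_le:
  assumes "finite T" "\<And>i. i \<le> l \<Longrightarrow> subspace (U i)" "\<And>i. i < l \<Longrightarrow> U i \<subseteq> U (Suc i)"
    and "\<And>i. i < l \<Longrightarrow> \<exists>v\<in>span T. v \<in> U (Suc i) \<and> v \<notin> U i"
  shows "l \<le> card T"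
proof -
  have "\<exists>S\<subseteq>span T. independent S \<and> finite S \<and> card S = k \<and> S \<subseteq> U k" if "k \<le> l" for k
    using that
  proof (induction k)
    case 0
    then show ?case by (intro exI[of _ "{}"]) (auto simp: independent_empty)
  next
    case (Suc k)
    then obtain S where S: "S \<subseteq> span T" "independent S" "finite S" "card S = k" "S \<subseteq> U k" by auto
    obtain v where v: "v \<in> span T" "v \<in> U (Suc k)" "v \<notin> U k"
      using assms(4)[of k] Suc.prems by auto
    have "span S \<subseteq> U k" using S assms(2) Suc.prems by (intro span_minimal) auto
    with v have "v \<notin> span S" by blast
    then have "independent (insert v S)" "v \<notin> S"
      using S by (simp add: independent_insertI, blast intro: span_base)
    with v S assms(3)[of k] Suc.prems show ?case
      by (intro exI[of _ "insert v S"]) auto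
  qed
  then obtain S where "S \<subseteq> span T" "independent S" "card S = l" by blast
  then show ?thesis using independent_span_bound[OF assms(1)] by blast
qed

lemma ideal_chain_length_le:
  fixes K :: "nat \<Rightarrow> 'k::field polynomial set"
  assumes "\<forall>i\<le>l. ideal (K i) (poly_ring m n) \<and> hk_ideal m n q \<subseteq> K i" "\<forall>i<l. K i \<subset> K (Suc i)"
  shows "l \<le> card {p. staircase m n p \<and> weight m n p \<in> small m n q}"
proof -
  let ?B = "{p. staircase m n p \<and> weight m n p \<in> small m n q}"
  have "l \<le> card (mon ` ?B :: 'k polynomial set)"
  proof (rule poly_vs.chain_length_le)
    show "finite (mon ` ?B :: 'k polynomial set)" using finite_bounded_staircase by blast
    show "poly_vs.subspace (K i)" if "i \<le> l" for i
      unfolding poly_vs.subspace_def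
      using assms(1) that ideal_poly_ringD(2-4)[of "K i" m n] by simp
    show "K i \<subseteq> K (Suc i)" if "i < l" for i using assms(2) that by blast
    show "\<exists>v\<in>poly_vs.span (mon ` ?B). v \<in> K (Suc i) \<and> v \<notin> K i" if i: "i < l" for i
    proof -
      have K: "ideal (K i) (poly_ring m n)" "hk_ideal m n q \<subseteq> K i"
        "ideal (K (Suc i)) (poly_ring m n)" "hk_ideal m n q \<subseteq> K (Suc i)"
        using assms(1) i by auto
      \<comment> \<open>Reducing a separating element \<open>f\<close> modulo
        \<open>hk_ideal\<close> gives one in the span; it still separates because both ideals
        contain \<open>hk_ideal\<close>.\<close>
      obtain f where f: "f \<in> K (Suc i)" "f \<notin> K i" using assms(2) i by blast
      obtain g where g: "g \<in> poly_vs.span (mon ` ?B)" "f - g \<in> hk_ideal m n q"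
        using cong_span_staircase[OF ideal_poly_ringD(1)[OF K(3) f(1)]] by blast
      have "g \<in> K (Suc i)" using ideal_poly_ring_diff[OF K(3) f(1), of "f - g"] g K by auto
      moreover have "g \<notin> K i" using ideal_poly_ringD(3)[OF K(1), of "f - g" g] g K f by auto
      ultimately show ?thesis using g by blast
    qed
  qed
  also have "\<dots> \<le> card ?B" by (rule card_image_le[OF finite_bounded_staircase])
  finally show ?thesis .
qed

section \<open>Lower bound: a chain of ideals freeing one weight at a time\<close>

lemma ex_ideal_chain:
  defines "l \<equiv> \<lambda>m n q. card {p. staircase m n p \<and> weight m n p \<in> small m n q}"
  shows "\<exists>K :: nat \<Rightarrow> 'k::field polynomial set.
    (\<forall>i\<le>l m n q. ideal (K i) (poly_ring m n) \<and> hk_ideal m n q \<subseteq> K i) \<and> (\<forall>i<l m n q. K i \<subset> K (Suc i))"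
proof -
  let ?B = "{p. staircase m n p \<and> weight m n p \<in> small m n q}"
  define deg where "deg p = sum_list (fst (weight m n p))" for p
  have deg_add: "deg (s + p) = deg s + deg p" for s p
  proof -
    have "row_sum n (s + p) = (\<lambda>i. row_sum n s i + row_sum n p i)"
      by (simp add: fun_eq_iff row_sum_add)
    then show ?thesis by (simp add: deg_def weight_def sum_list_addf del: upt_Suc)
  qed
  obtain as where as: "set as = ?B" "distinct as" using finite_distinct_list[OF finite_bounded_staircase] by blast
  \<comment> \<open>Since \<open>bs\<close> is sorted by degree, the weights of each initial segment are closed under divisors.\<close>
  define bs where "bs = sort_key deg as"
  have bs: "set bs = ?B" "distinct bs" "sorted (map deg bs)" using as by (simp_all add: bs_def)
  have len: "length bs = l m n q" using bs distinct_card[of bs] by (simp add: l_def)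
  define W where "W k = weight m n ` set (take k bs)" for k
  \<comment> \<open>The index is reversed: \<open>K i\<close> imposes vanishing at the first
    \<open>l - i\<close> weights, so the last ideal is the whole ring and weights are freed from the
    highest degree down.\<close>
  define K where "K i = (vanishing m n (W (l m n q - i)) :: 'k polynomial set)" for i
  have W_sub: "W k \<subseteq> small m n q" for k using set_take_subset[of k bs] bs by (auto simp: W_def)
  have W_ideal: "ideal (vanishing m n (W k) :: 'k polynomial set) (poly_ring m n)" for k
  proof (rule ideal_vanishing)
    fix s p assume sp: "s \<in> monomials m n" "p \<in> monomials m n" "weight m n (s + p) \<in> W k"
    then obtain a where a: "a < k" "a < length bs" "weight m n (s + p) = weight m n (bs ! a)"
      unfolding W_def by (auto simp: in_set_conv_nth)
    \<comment> \<open>The divisor \<open>p\<close> need not be staircase, so its position in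
      \<open>bs\<close> is that of the staircase monomial of the same weight.\<close>
    obtain p' where p': "staircase m n p'" "weight m n p' = weight m n p"
      using ex_staircase_weight sp by blast
    have "weight m n (s + p) \<in> small m n q" using W_sub sp by blast
    then have "weight m n p \<in> small m n q" by (rule small_down_closed)
    then have "p' \<in> set bs" using p' bs by auto
    then obtain b where b: "b < length bs" "p' = bs ! b" by (auto simp: in_set_conv_nth)
    have dab: "deg (bs ! a) = deg s + deg (bs ! b)"
      using deg_add[of s p] a(3) p'(2) b(2) unfolding deg_def by simp
    \<comment> \<open>If the divisor came later, sorting would force \<open>deg s = 0\<close>; then
      \<open>s\<close> has zero weight, both list entries have the same weight, and distinctness is
      violated.\<close>
    have "b \<le> a"
    proof (rule ccontr)
      assume "\<not> b \<le> a"
      then have "deg (bs ! a) \<le> deg (bs ! b)"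
        using sorted_nth_mono[OF bs(3), of a b] a b by simp
      then have "deg s = 0" using dab by simp
      then have 1: "sum_list (fst (weight m n s)) = 0" unfolding deg_def .
      then have 2: "sum_list (snd (weight m n s)) = 0" unfolding sum_list_weight .
      have "weight m n s = weight m n 0"
        using 1 2 unfolding weight_eq_iff by (simp add: weight_def del: upt_Suc)
      then have "weight m n (p + s) = weight m n (p + 0)" by (simp only: weight_add_cancel)
      then have "weight m n (s + p) = weight m n p" unfolding add.commute[of s p] add_0_right .
      then have "weight m n (bs ! a) = weight m n (bs ! b)"
        unfolding a(3) p'(2)[symmetric] b(2) .
      moreover have "staircase m n (bs ! a)" "staircase m n (bs ! b)"
        using bs(1) nth_mem[OF a(2)] nth_mem[OF b(1)] by auto
      ultimately have "bs ! a = bs ! b" by (intro staircase_weight_inj)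
      then have "a = b" using bs(2) a b by (simp add: nth_eq_iff_index_eq)
      with \<open>\<not> b \<le> a\<close> show False by simp
    qed
    then have "take k bs ! b = p'" "b < length (take k bs)" using a b by simp_all
    then have "p' \<in> set (take k bs)" by (metis nth_mem)
    then show "weight m n p \<in> W k" unfolding W_def p'(2)[symmetric] by blast
  qed
  have "K i \<subset> K (Suc i)" if i: "i < l m n q" for i
  proof -
    define k where "k = l m n q - Suc i"
    have k: "l m n q - i = Suc k" "k < length bs" using i len by (auto simp: k_def)
    have W_Suc: "W (Suc k) = insert (weight m n (bs ! k)) (W k)"
      using k by (simp add: W_def take_Suc_conv_app_nth)
    have st: "staircase m n (bs ! j)" if "j < length bs" for j using bs nth_mem[OF that] by auto
    have "weight m n (bs ! k) \<notin> W k"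
    proof
      assume "weight m n (bs ! k) \<in> W k"
      then obtain j where j: "j < k" "j < length bs" "weight m n (bs ! k) = weight m n (bs ! j)"
        unfolding W_def by (auto simp: in_set_conv_nth)
      then have "bs ! k = bs ! j" using staircase_weight_inj st k by blast
      then show False using bs(2) j k by (simp add: nth_eq_iff_index_eq)
    qed
    \<comment> \<open>The monomial of the newly freed weight witnesses strictness.\<close>
    then have "mon (bs ! k) \<in> (vanishing m n (W k) :: 'k polynomial set)"
      "mon (bs ! k) \<notin> (vanishing m n (W (Suc k)) :: 'k polynomial set)"
      using st[OF k(2)] by (auto simp: vanishing_def wcoeff_single W_Suc staircase_def)
    moreover have "vanishing m n (W (Suc k)) \<subseteq> (vanishing m n (W k) :: 'k polynomial set)"
      by (auto simp: vanishing_def W_Suc)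
    ultimately show ?thesis unfolding K_def k(1) k_def[symmetric] by blast
  qed
  moreover have "ideal (K i) (poly_ring m n) \<and> hk_ideal m n q \<subseteq> K i" for i
    unfolding K_def using W_ideal hk_ideal_vanishing[OF W_sub W_ideal] by blast
  ultimately show ?thesis by blast
qed

lemma hilbert_kunz_eq_card:
  "hilbert_kunz (poly_ring m n :: 'k::field polynomial ring) (I2 m n) (vars m n) q
    = enat (card {p. staircase m n p \<and> weight m n p \<in> small m n q})"
proof -
  interpret cring "poly_ring m n :: 'k polynomial ring" by (rule cring_poly_ring)
  have "hilbert_kunz (poly_ring m n :: 'k polynomial ring) (I2 m n) (vars m n) q
    = Sup {enat l | l. \<exists>K :: nat \<Rightarrow> 'k polynomial set.
        (\<forall>i\<le>l. ideal (K i) (poly_ring m n) \<and> hk_ideal m n q \<subseteq> K i) \<and> (\<forall>i<l. K i \<subset> K (Suc i))}"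
    unfolding hilbert_kunz_def hk_ideal_def[symmetric]
    by (rule module_length_quot_module[OF ideal_hk_ideal])
  also have "\<dots> = enat (card {p. staircase m n p \<and> weight m n p \<in> small m n q})"
    (is "?L = ?R")
  proof (rule antisym)
    show "?L \<le> ?R"
      by (rule Sup_least) (auto dest!: ideal_chain_length_le)
    show "?R \<le> ?L"
      using ex_ideal_chain[where 'k = 'k, of m n q] by (intro Sup_upper) blast
  qed
  finally show ?thesis .
qed

theorem theorem3p3:
  fixes m n q :: nat
  assumes "m > 0" and "n > 0" and "q > 0"
  shows "hilbert_kunz (poly_ring m n :: 'k::field polynomial ring) (I2 m n) (vars m n) q
           = enat (N_count q m n (\<lambda>_. \<infinity>) (\<lambda>_. \<infinity>)) \<and>
         N_count q m n (\<lambda>_. \<infinity>) (\<lambda>_. \<infinity>)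
           = N_count q m n (\<lambda>_. \<infinity>) (\<lambda>_. enat (q - 1))
             + M_count q m n (\<lambda>_. enat (q - 1)) (\<lambda>_. enat (q - 1)) \<and>
         int (N_count q m n (\<lambda>_. \<infinity>) (\<lambda>_. enat (q - 1))
              + M_count q m n (\<lambda>_. enat (q - 1)) (\<lambda>_. enat (q - 1)))
           = (\<Sum>i=1..n. (-1) ^ (n - i) * int (n choose i)
                * binom (int i * int q + int m - 1) (m + n - 1))
             + (\<Sum>i=1..n. \<Sum>j=1..m. (-1) ^ (m - j + i - 1) * int (n choose i) * int (m choose j)
                * binom (int j * int q - int i * int q + int n - 1) (m + n - 1))"
  using hilbert_kunz_eq_card[where 'k = 'k, of m n q] N_count_eq[of q m n] N_count_split[OF \<open>q > 0\<close>, of m n]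
    N_count_bounded_formula[OF assms] M_count_formula[OF assms]
  by simp

end
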